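(* Let $G$ be a complete geometric graph. A subgraph $B$ of $G$ is a blocker for the family of all simple spanning trees of $G$ if and only if $B$ is either a star of $G$ or a comb of $G$.
   Context: A geometric graph is a graph whose vertices are points in the plane in general position (no three collinear) and whose edges are straight segments between pairs of vertices; $G$ is complete if all pairs of vertices are joined. A geometric graph is simple if no two of its edges cross. A simple spanning tree (SST) of $G$ is a non-crossing spanning tree of $G$. For a family $\mathcal{F}$ of subgraphs of $G$, a subgraph $B$ blocks $\mathcal{F}$ if it shares at least one edge with every member of $\mathcal{F}$; a blocker of $\mathcal{F}$ is a subgraph that blocks $\mathcal{F}$ and has the smallest possible number of edges among all subgraphs blocking $\mathcal{F}$. A star of $G$ is the set of all edges of $G$ emanating from a single vertex. Boundary vertices/edges are those lying on the boundary of $\mathrm{conv}(G)$, the convex hull of $V(G)$. A comb of $G$ is a simple spanning subgraph $B$ of $G$ such that: (1) the intersection of $B$ with the boundary of $\mathrm{conv}(G)$ is a simple path $P$ (the spine of $B$); (2) each vertex in $V(G)\setminus P$ is connected by a unique edge of $B$ to an interior (non-endpoint) vertex of $P$; (3) for each edge $e$ of $B$, the line spanned by $e$ does not cross any edge of $B$.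
   Formalization: A comb is taken to have no edges other than its spine and the single edge at each vertex off the spine (a diagonal p0p2 added to the spine p0p1p2p3 of a convex quadrilateral would otherwise be a comb but no blocker), and G has at least two vertices (for one vertex the empty star blocks nothing). *)

theory Defs
  imports "HOL-Analysis.Analysis"
begin

type_synonym point = "real^2"
type_synonym edge = "point set"   (* an edge is the 2-element set of its endpoints *)

definition general_position :: "point set \<Rightarrow> bool" where
  "general_position V \<longleftrightarrow> finite V \<and>
     (\<forall>a\<in>V. \<forall>b\<in>V. \<forall>c\<in>V. a \<noteq> b \<and> a \<noteq> c \<and> b \<noteq> c \<longrightarrow> \<not> collinear {a, b, c})"

definition cg_edges :: "point set \<Rightarrow> edge set" where
  "cg_edges V = {{a, b} | a b. a \<in> V \<and> b \<in> V \<and> a \<noteq> b}"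

definition edges_cross :: "edge \<Rightarrow> edge \<Rightarrow> bool" where
  "edges_cross e f \<longleftrightarrow> e \<inter> f = {} \<and> convex hull e \<inter> convex hull f \<noteq> {}"

definition simple_graph :: "edge set \<Rightarrow> bool" where
  "simple_graph B \<longleftrightarrow> (\<forall>e\<in>B. \<forall>f\<in>B. \<not> edges_cross e f)"

definition linked :: "edge set \<Rightarrow> point \<Rightarrow> point \<Rightarrow> bool" where
  "linked T u v \<longleftrightarrow> (u, v) \<in> {(a, b). {a, b} \<in> T}\<^sup>*"

text \<open>Spanning tree of V: connected on V and acyclic (no edge lies on a cycle,
  i.e. deleting any edge disconnects its endpoints).\<close>
definition spanning_tree :: "point set \<Rightarrow> edge set \<Rightarrow> bool" where
  "spanning_tree V T \<longleftrightarrow> T \<subseteq> cg_edges V \<and>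
     (\<forall>u\<in>V. \<forall>v\<in>V. linked T u v) \<and>
     (\<forall>e\<in>T. \<forall>a b. e = {a, b} \<longrightarrow> \<not> linked (T - {e}) a b)"

definition SSTs :: "point set \<Rightarrow> edge set set" where
  "SSTs V = {T. spanning_tree V T \<and> simple_graph T}"

definition blocks :: "edge set set \<Rightarrow> edge set \<Rightarrow> bool" where
  "blocks F B \<longleftrightarrow> (\<forall>T\<in>F. B \<inter> T \<noteq> {})"

definition blocker :: "point set \<Rightarrow> edge set set \<Rightarrow> edge set \<Rightarrow> bool" where
  "blocker V F B \<longleftrightarrow> B \<subseteq> cg_edges V \<and> blocks F B \<and>
     (\<forall>B'. B' \<subseteq> cg_edges V \<and> blocks F B' \<longrightarrow> card B \<le> card B')"

definition star :: "point set \<Rightarrow> point \<Rightarrow> edge set" where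
  "star V v = {e \<in> cg_edges V. v \<in> e}"

definition is_star :: "point set \<Rightarrow> edge set \<Rightarrow> bool" where
  "is_star V B \<longleftrightarrow> (\<exists>v\<in>V. B = star V v)"

definition boundary_edge :: "point set \<Rightarrow> edge \<Rightarrow> bool" where
  "boundary_edge V e \<longleftrightarrow> e \<in> cg_edges V \<and> convex hull e \<subseteq> frontier (convex hull V)"

definition path_edges :: "point list \<Rightarrow> edge set" where
  "path_edges ps = {{ps ! i, ps ! Suc i} | i. Suc i < length ps}"

text \<open>The line spanned by e crosses edge f (f has points strictly on both sides).\<close>
definition line_crosses :: "edge \<Rightarrow> edge \<Rightarrow> bool" where
  "line_crosses e f \<longleftrightarrow> affine hull e \<inter> (convex hull f - f) \<noteq> {} \<and> \<not> f \<subseteq> affine hull e"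

definition comb :: "point set \<Rightarrow> edge set \<Rightarrow> bool" where
  "comb V B \<longleftrightarrow> B \<subseteq> cg_edges V \<and> simple_graph B \<and>
     (\<exists>ps. length ps \<ge> 2 \<and> distinct ps \<and> set ps \<subseteq> V \<and>
        {e \<in> B. boundary_edge V e} = path_edges ps \<and>
        (\<forall>v \<in> V - set ps. \<exists>!e. e \<in> B \<and> v \<in> e) \<and>
        (\<forall>e\<in>B. e \<in> path_edges ps \<or>
            (\<exists>v \<in> V - set ps. \<exists>q \<in> set (butlast (tl ps)). e = {v, q}))) \<and>
     (\<forall>e\<in>B. \<forall>f\<in>B. \<not> line_crosses e f)"

end

theory Submission
  imports Defs
begin

text \<open>
  Every 2-colouring of the edges of a complete geometric graph has a monochromatic simple
  spanning tree (Karolyi, Pach and Toth). So a set B blocking all simple spanning trees contains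
  one, stars show that the minimum size is \<open>|V| - 1\<close>, and a blocker is itself a spanning tree.
  The same applies to the vertices on either side of a line: if the line splits V into two parts
  sharing a vertex, then B must block, hence connect, one of the two parts. Combined with the
  acyclicity of B this shows that no line spanned by an edge of B crosses another edge of B.
  If a hull edge uv is missing from B, then u and v are leaves of B, and deleting u leaves a
  blocker of \<open>V - {u}\<close>. By induction, edges joining two non-leaves of B are hull edges, so the
  non-leaves of B form a single vertex (a star) or a path along the hull (a comb).

  Conversely, let T be a simple graph without isolated vertices avoiding a comb with spine
  \<open>p\<^sub>0, \<dots>, p\<^sub>k\<close>. An edge of T at \<open>p\<^sub>i\<close> points right or left, according to where the spine meets
  the tooth at its other end. At \<open>p\<^sub>0\<close> all edges point right and at \<open>p\<^sub>k\<close> all point left, so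
  for some i there are a right edge at \<open>p\<^sub>i\<close> and a left edge at the next spine vertex. These cross.
\<close>

section \<open>Orientation of point triples\<close>

text \<open>Edges on opposite sides of a line can meet only on that line, so simple spanning graphs
  of the two halves have a simple union. The union is connected if the halves share a vertex, or
  once a hull edge, which nothing crosses, is added between them. If the complement of B spanned
  both halves, it would therefore span V; this is why B must block one half. Each end of the edge
  spanning the line may be given to either half, which yields several alternatives, and acyclicity
  of B excludes their combinations. The count |V| - 1 is used twice: it makes B a tree, and it
  leaves a single edge at a vertex whose removal keeps B blocking. A hull edge is missing from B
  because a tree cannot contain the whole hull cycle. In the converse, the obstacle is the angular
  order around a spine vertex: everything attached later along the spine must precede everything
  attached earlier. The line condition settles this only for vertices attached at that spine vertex;
  two vertices attached on different sides of it need a convex quadrilateral.\<close>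

text \<open>Twice the signed area of the triangle abc, positive iff c lies left of the line directed
  from a to b. Sides, hulls and crossings are all expressed through its sign.\<close>

definition orient :: "point \<Rightarrow> point \<Rightarrow> point \<Rightarrow> real" where
  "orient a b c = (b$1 - a$1) * (c$2 - a$2) - (b$2 - a$2) * (c$1 - a$1)"

lemma orient_rotate: "orient a b c = orient b c a"
  by (simp add: orient_def algebra_simps)

lemma orient_swap: "orient a c b = - orient a b c"
  by (simp add: orient_def algebra_simps)

lemma orient_flip: "orient b a c = - orient a b c"
  by (simp add: orient_def algebra_simps)

lemma orient_degenerate [simp]: "orient a a b = 0" "orient a b a = 0" "orient a b b = 0"
  by (simp_all add: orient_def)

lemma orient_affine:
  "orient p q ((1 - u) *\<^sub>R x + u *\<^sub>R y) = (1 - u) * orient p q x + u * orient p q y"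
  by (simp add: orient_def algebra_simps)

lemma orient_eq_0_imp_affine_hull:
  assumes "a \<noteq> b" "orient a b c = 0"
  shows "c \<in> affine hull {a, b}"
proof -
  have nz: "b$1 - a$1 \<noteq> 0 \<or> b$2 - a$2 \<noteq> 0"
    using assms(1) by (auto simp: vec_eq_iff forall_2)
  obtain t where t: "c = (1 - t) *\<^sub>R a + t *\<^sub>R b"
  proof (cases "b$1 - a$1 = 0")
    case False
    define t where "t = (c$1 - a$1) / (b$1 - a$1)"
    have 1: "t * (b$1 - a$1) = c$1 - a$1" using False by (simp add: t_def)
    have "(b$1 - a$1) * (c$2 - a$2) = (b$1 - a$1) * (t * (b$2 - a$2))"
      using assms(2) 1 unfolding orient_def by algebra
    with False have "c$2 - a$2 = t * (b$2 - a$2)" by simp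
    with 1 show ?thesis by (intro that[of t]) (simp add: vec_eq_iff forall_2 algebra_simps)
  next
    case True
    with nz have nz2: "b$2 - a$2 \<noteq> 0" by simp
    define t where "t = (c$2 - a$2) / (b$2 - a$2)"
    have 1: "t * (b$2 - a$2) = c$2 - a$2" using nz2 by (simp add: t_def)
    have "c$1 = a$1" using assms(2) True nz2 by (simp add: orient_def)
    with 1 True show ?thesis by (intro that[of t]) (simp add: vec_eq_iff forall_2 algebra_simps)
  qed
  show ?thesis unfolding affine_hull_2 t by auto (metis diff_add_cancel)
qed

lemma affine_hull_imp_orient_eq_0:
  assumes "c \<in> affine hull {a, b}"
  shows "orient a b c = 0"
proof -
  obtain u v where c: "c = u *\<^sub>R a + v *\<^sub>R b" and "u + v = 1"
    using assms by (auto simp: affine_hull_2)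
  then have "u = 1 - v" by simp
  then show ?thesis by (simp add: c orient_affine)
qed

lemma general_position_orient:
  assumes "general_position V" "a \<in> V" "b \<in> V" "c \<in> V" "a \<noteq> b" "a \<noteq> c" "b \<noteq> c"
  shows "orient a b c \<noteq> 0"
  using assms orient_eq_0_imp_affine_hull[of a b c] collinear_3_affine_hull[of a b c]
  unfolding general_position_def by blast

lemma general_position_subset:
  "general_position V \<Longrightarrow> W \<subseteq> V \<Longrightarrow> general_position W"
  unfolding general_position_def by (meson finite_subset subsetD)

lemma convex_hull_doubleton:
  fixes x y :: "'a::real_vector"
  shows "z \<in> convex hull {x, y} \<longleftrightarrow> (\<exists>u. 0 \<le> u \<and> u \<le> 1 \<and> z = (1 - u) *\<^sub>R x + u *\<^sub>R y)"
proof -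
  have "z \<in> closed_segment x y \<longleftrightarrow> (\<exists>u. 0 \<le> u \<and> u \<le> 1 \<and> z = (1 - u) *\<^sub>R x + u *\<^sub>R y)"
    by (auto simp: closed_segment_def)
  then show ?thesis by (simp add: segment_convex_hull)
qed

text \<open>A common point \<open>z\<close> has value at most 0 as a point of \<open>e\<close> and
  at least 0 as a point of \<open>f\<close>, so it lies on the line. On each edge it is then an
  endpoint from \<open>{p, q}\<close>, unless the edge is \<open>{p, q}\<close> itself; in every
  combination the edges share an endpoint, which crossing edges do not.\<close>

lemma separated_not_cross:
  assumes e: "e = {e1, e2}" "e1 \<noteq> e2" and f: "f = {f1, f2}" "f1 \<noteq> f2"
    and neg: "\<And>x. x \<in> e \<Longrightarrow> orient p q x \<le> 0" and pos: "\<And>x. x \<in> f \<Longrightarrow> orient p q x \<ge> 0"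
    and zero: "\<And>x. x \<in> e \<union> f \<Longrightarrow> orient p q x = 0 \<Longrightarrow> x \<in> {p, q}"
  shows "\<not> edges_cross e f"
proof
  assume "edges_cross e f"
  then obtain z where disj: "e \<inter> f = {}" and z: "z \<in> convex hull e" "z \<in> convex hull f"
    unfolding edges_cross_def by blast
  obtain s where s: "0 \<le> s" "s \<le> 1" "z = (1 - s) *\<^sub>R e1 + s *\<^sub>R e2"
    using z(1) unfolding e convex_hull_doubleton by blast
  obtain t where t: "0 \<le> t" "t \<le> 1" "z = (1 - t) *\<^sub>R f1 + t *\<^sub>R f2"
    using z(2) unfolding f convex_hull_doubleton by blast
  have z1: "orient p q z = (1 - s) * orient p q e1 + s * orient p q e2"
    using s(3) orient_affine by simp
  have z2: "orient p q z = (1 - t) * orient p q f1 + t * orient p q f2"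
    using t(3) orient_affine by simp
  have a: "(1 - s) * orient p q e1 \<le> 0" "s * orient p q e2 \<le> 0"
    using neg[of e1] neg[of e2] s e by (auto intro: mult_nonneg_nonpos)
  have b: "(1 - t) * orient p q f1 \<ge> 0" "t * orient p q f2 \<ge> 0"
    using pos[of f1] pos[of f2] t f by auto
  have E: "(1 - s) * orient p q e1 = 0" "s * orient p q e2 = 0"
    "(1 - t) * orient p q f1 = 0" "t * orient p q f2 = 0" using a b z1 z2 by linarith+
  have es: "(z \<in> e \<and> z \<in> {p, q}) \<or> e = {p, q}"
    using E(1,2) s(3) zero[of e1] zero[of e2] e by (cases "s = 0"; cases "s = 1") auto
  have fs: "(z \<in> f \<and> z \<in> {p, q}) \<or> f = {p, q}"
    using E(3,4) t(3) zero[of f1] zero[of f2] f by (cases "t = 0"; cases "t = 1") auto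
  from es fs disj e f show False by blast
qed

text \<open>Cramer's rule: \<open>t\<close> on cd and \<open>s\<close> on ab are the parameters of
  the point where the two lines meet, and the sign conditions place both in the unit
  interval.\<close>

lemma opposite_sides_cross:
  assumes "orient a b c * orient a b d < 0" "orient c d a * orient c d b < 0"
  shows "edges_cross {a, b} {c, d}"
proof -
  let ?p = "orient a b c" and ?q = "orient a b d" and ?r = "orient c d a" and ?s = "orient c d b"
  have ne: "?p - ?q \<noteq> 0" "?r - ?s \<noteq> 0"
    using assms mult_less_0_iff[of ?p ?q] mult_less_0_iff[of ?r ?s] by auto
  define t where "t = ?p / (?p - ?q)"
  define s where "s = ?r / (?r - ?s)"
  have pq: "0 \<le> t \<and> t \<le> 1" using assms(1) unfolding t_def
    by (auto simp: mult_less_0_iff divide_simps)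
  have rs: "0 \<le> s \<and> s \<le> 1" using assms(2) unfolding s_def
    by (auto simp: mult_less_0_iff divide_simps)
  have t: "t * (?p - ?q) = ?p" and s: "s * (?r - ?s) = ?r"
    using ne by (simp_all add: t_def s_def)
  \<comment> \<open>Both differences are, up to sign, the cross product of b - a and d - c, so one
    denominator serves both parameters.\<close>
  have rel: "?p - ?q = - (?r - ?s)"
    by (simp add: orient_def algebra_simps)
  have c1: "(?p - ?q) * (((1 - t) * c$i + t * d$i)) = (?p - ?q) * ((1 - s) * a$i + s * b$i)" for i
  proof -
    have "(?p - ?q) * c$i + ?p * (d$i - c$i) = (?p - ?q) * a$i - ?r * (b$i - a$i)"
      using exhaust_2[of i] by (auto simp: orient_def algebra_simps)
    then show ?thesis using t s rel by algebra
  qed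
  then have "(1 - t) *\<^sub>R c + t *\<^sub>R d = (1 - s) *\<^sub>R a + s *\<^sub>R b"
    using ne by (simp add: vec_eq_iff)
  then have "convex hull {a, b} \<inter> convex hull {c, d} \<noteq> {}"
    using pq rs convex_hull_doubleton by blast
  moreover have "{a, b} \<inter> {c, d} = {}" using assms by auto
  ultimately show ?thesis unfolding edges_cross_def by blast
qed

text \<open>The affine map \<open>orient a b\<close> vanishes at the intersection point, which is a
  proper convex combination of \<open>x\<close> and \<open>y\<close>. The values at \<open>x\<close>
  and \<open>y\<close> are then opposite unless both vanish, and that is what the last clause of
  \<open>line_crosses\<close> excludes.\<close>

lemma line_crosses_iff:
  assumes gp: "general_position V" and V: "a \<in> V" "b \<in> V" "x \<in> V" "y \<in> V" and ne: "a \<noteq> b"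
  shows "line_crosses {a, b} {x, y} \<longleftrightarrow> orient a b x * orient a b y < 0"
proof
  assume "line_crosses {a, b} {x, y}"
  then obtain z where z: "z \<in> affine hull {a, b}" "z \<in> convex hull {x, y}" "z \<noteq> x" "z \<noteq> y"
    and nsub: "\<not> {x, y} \<subseteq> affine hull {a, b}"
    unfolding line_crosses_def by blast
  obtain u where u: "0 \<le> u" "u \<le> 1" "z = (1 - u) *\<^sub>R x + u *\<^sub>R y"
    using z(2) unfolding convex_hull_doubleton by blast
  have "u \<noteq> 0" "u \<noteq> 1" using u z by auto
  then have u': "0 < u" "u < 1" using u by auto
  have s: "(1 - u) * orient a b x + u * orient a b y = 0"
    using affine_hull_imp_orient_eq_0[OF z(1)] u(3) orient_affine by simp
  have "orient a b x \<noteq> 0 \<or> orient a b y \<noteq> 0"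
    using nsub orient_eq_0_imp_affine_hull[OF ne] by blast
  then have nz: "orient a b x \<noteq> 0" using s u' by auto
  have "u * (orient a b x * orient a b y) = - (1 - u) * (orient a b x)\<^sup>2"
    using s by (simp add: power2_eq_square) algebra
  also have "\<dots> < 0" using u' nz by (simp add: mult_less_0_iff)
  finally show "orient a b x * orient a b y < 0" using u' by (simp add: mult_less_0_iff)
next
  let ?p = "orient a b x" and ?q = "orient a b y"
  assume opp: "?p * ?q < 0"
  then have ne': "?p - ?q \<noteq> 0" using mult_less_0_iff[of ?p ?q] by auto
  define t where "t = ?p / (?p - ?q)"
  have t: "0 \<le> t \<and> t \<le> 1" using opp unfolding t_def by (auto simp: mult_less_0_iff divide_simps)
  define z where "z = (1 - t) *\<^sub>R x + t *\<^sub>R y"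
  have tt: "t * (?p - ?q) = ?p" using ne' by (simp add: t_def)
  have "orient a b z = 0" unfolding z_def orient_affine using tt by (simp add: algebra_simps)
  moreover have "z \<in> convex hull {x, y}" unfolding convex_hull_doubleton z_def using t by blast
  moreover have "\<not> {x, y} \<subseteq> affine hull {a, b}"
    using opp affine_hull_imp_orient_eq_0 by fastforce
  moreover have "z \<notin> {x, y}" using \<open>orient a b z = 0\<close> opp by auto
  ultimately show "line_crosses {a, b} {x, y}"
    unfolding line_crosses_def using orient_eq_0_imp_affine_hull[OF ne] by blast
qed

text \<open>Expresses the affine function of the line cd through those of ab, bc and da. For a convex
  quadrilateral abcd its coefficients show that a point right of ab but left of bc and da is left of cd.\<close>
lemma orient_quad_identity:
  "orient c d x * orient a b c * orient a b d =
   - orient c d b * orient d a c * orient a b x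
   + orient c d a * orient a b d * orient b c x
   + orient c d b * orient a b c * orient d a x"
  unfolding orient_def by algebra

text \<open>The weights are barycentric coordinates of d in the triangle abc, so \<open>orient e d\<close>
  vanishes there. Used to exclude a hull vertex d from the interior of a triangle.\<close>
lemma orient_triangle_identity:
  "orient b c d * orient e d a + orient c a d * orient e d b + orient a b d * orient e d c = 0"
  unfolding orient_def by algebra

section \<open>Connected simple spanning graphs\<close>

lemma linked_refl [simp]: "linked T u u"
  by (simp add: linked_def)

lemma linked_trans: "linked T u v \<Longrightarrow> linked T v w \<Longrightarrow> linked T u w"
  unfolding linked_def by (rule rtrancl_trans)

lemma linked_edge: "{u, v} \<in> T \<Longrightarrow> linked T u v"
  unfolding linked_def by blast

lemma linked_sym: "linked T u v \<Longrightarrow> linked T v u"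
  unfolding linked_def
  by (rule symD[OF sym_rtrancl]) (simp_all add: sym_def insert_commute)

lemma linked_mono: "linked T u v \<Longrightarrow> T \<subseteq> T' \<Longrightarrow> linked T' u v"
  using rtrancl_mono[of "{(a, b). {a, b} \<in> T}" "{(a, b). {a, b} \<in> T'}"]
  unfolding linked_def by blast

lemma linked_induct [consumes 1, case_names refl step]:
  assumes "linked T u v" "P u" "\<And>x y. linked T u x \<Longrightarrow> {x, y} \<in> T \<Longrightarrow> P x \<Longrightarrow> P y"
  shows "P v"
proof -
  have "(u, v) \<in> {(a, b). {a, b} \<in> T}\<^sup>*" using assms(1) by (simp add: linked_def)
  then show ?thesis
  proof (induction rule: rtrancl_induct)
    case (step y z)
    then show ?case using assms(3)[of y z] by (simp add: linked_def)
  qed (rule assms(2))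
qed

text \<open>Each use of the edge ab in a walk is replaced by the detour that avoids it.\<close>

lemma linked_remove_cycle_edge:
  assumes "linked (T - {{a, b}}) a b" "linked T u v"
  shows "linked (T - {{a, b}}) u v"
  using assms(2)
proof (induction rule: linked_induct)
  case (step x y)
  have "linked (T - {{a, b}}) x y"
  proof (cases "{x, y} = {a, b}")
    case True
    then show ?thesis using assms(1) linked_sym by (auto simp: doubleton_eq_iff)
  next
    case False
    then show ?thesis using step.hyps by (intro linked_edge) auto
  qed
  then show ?case using step.IH linked_trans by blast
qed simp

text \<open>Walks must stay inside \<open>S\<close>. The intersection with \<open>cg_edges S\<close>
  allows the same edge set \<open>B\<close> to be tested on many vertex sets.\<close>

definition connected_on :: "point set \<Rightarrow> edge set \<Rightarrow> bool" where
  "connected_on S T \<longleftrightarrow> (\<forall>u\<in>S. \<forall>v\<in>S. linked (T \<inter> cg_edges S) u v)"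

text \<open>Asking for connectivity instead of a tree lets graphs be glued without checking
  acyclicity. \<open>E\<close> is meant to be \<open>B\<close> or its complement, the two colours of
  an edge colouring.\<close>

definition contains_simple_spanning :: "edge set \<Rightarrow> point set \<Rightarrow> bool" where
  "contains_simple_spanning E S \<longleftrightarrow>
     (\<exists>T. T \<subseteq> E \<inter> cg_edges S \<and> simple_graph T \<and> connected_on S T)"

lemma cg_edgesI: "a \<in> V \<Longrightarrow> b \<in> V \<Longrightarrow> a \<noteq> b \<Longrightarrow> {a, b} \<in> cg_edges V"
  unfolding cg_edges_def by blast

lemma cg_edges_mono: "S \<subseteq> V \<Longrightarrow> cg_edges S \<subseteq> cg_edges V"
  unfolding cg_edges_def by blast

lemma doubleton_in_cg_edges: "{a, b} \<in> cg_edges V \<longleftrightarrow> a \<in> V \<and> b \<in> V \<and> a \<noteq> b"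
  unfolding cg_edges_def by (auto simp: doubleton_eq_iff)

lemma finite_cg_edges: "finite V \<Longrightarrow> finite (cg_edges V)"
  by (rule finite_subset[of _ "Pow V"]) (auto simp: cg_edges_def)

lemma connected_on_mono: "connected_on S T \<Longrightarrow> T \<subseteq> T' \<Longrightarrow> connected_on S T'"
  unfolding connected_on_def by (meson Int_mono linked_mono order_refl)

lemma connected_on_linked:
  "connected_on S T \<Longrightarrow> u \<in> S \<Longrightarrow> v \<in> S \<Longrightarrow> T \<inter> cg_edges S \<subseteq> T' \<Longrightarrow> linked T' u v"
  unfolding connected_on_def using linked_mono[of "T \<inter> cg_edges S" _ _ T'] by blast

lemma linked_hub_imp_connected_on:
  assumes "\<And>v. v \<in> S \<Longrightarrow> linked (T \<inter> cg_edges S) v r"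
  shows "connected_on S T"
  unfolding connected_on_def
proof (intro ballI)
  fix u v assume "u \<in> S" "v \<in> S"
  from linked_trans[OF assms[OF this(1)] linked_sym[OF assms[OF this(2)]]]
  show "linked (T \<inter> cg_edges S) u v" .
qed

text \<open>A connected subgraph with the fewest edges is acyclic, because an edge on a cycle could
  still be deleted.\<close>

lemma finite_simple_connected_has_SST:
  assumes fin: "finite V" and T: "T \<subseteq> cg_edges V" "simple_graph T" "connected_on V T"
  obtains T0 where "T0 \<subseteq> T" "T0 \<in> SSTs V"
proof -
  let ?P = "\<lambda>X. X \<subseteq> T \<and> connected_on V X"
  have "finite T" using finite_subset[OF T(1) finite_cg_edges[OF fin]] .
  obtain T0 where T0: "?P T0" and minimal: "\<And>X. ?P X \<Longrightarrow> card T0 \<le> card X"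
    using ex_has_least_nat[of ?P T card] T(3) by blast
  have sub: "T0 \<inter> cg_edges V = T0" using T0 T(1) by blast
  have finT0: "finite T0" using T0 \<open>finite T\<close> finite_subset by blast
  have "\<not> linked (T0 - {e}) a b" if e: "e \<in> T0" "e = {a, b}" for e a b
  proof
    assume "linked (T0 - {e}) a b"
    then have "\<And>u v. linked T0 u v \<Longrightarrow> linked (T0 - {e}) u v"
      using linked_remove_cycle_edge[of T0 a b] e by simp
    moreover have "(T0 - {e}) \<inter> cg_edges V = T0 - {e}" using sub by blast
    ultimately have "connected_on V (T0 - {e})"
      using T0 sub unfolding connected_on_def by simp
    then have "card T0 \<le> card (T0 - {e})" using minimal T0 by blast
    then show False using card_Diff1_less[OF finT0 e(1)] by simp
  qed
  moreover have "simple_graph T0" using T(2) T0 unfolding simple_graph_def by blast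
  ultimately have "T0 \<in> SSTs V"
    using T0 T(1) sub unfolding SSTs_def spanning_tree_def connected_on_def by auto
  then show ?thesis using that T0 by blast
qed

lemma blocks_SSTs_iff:
  assumes "finite V"
  shows "blocks (SSTs V) B \<longleftrightarrow> \<not> contains_simple_spanning (- B) V"
proof
  assume b: "blocks (SSTs V) B"
  show "\<not> contains_simple_spanning (- B) V"
  proof
    assume "contains_simple_spanning (- B) V"
    then obtain T where T: "T \<subseteq> - B \<inter> cg_edges V" "simple_graph T" "connected_on V T"
      unfolding contains_simple_spanning_def by blast
    then obtain T0 where "T0 \<subseteq> T" "T0 \<in> SSTs V"
      using finite_simple_connected_has_SST[OF assms, of T] by blast
    then show False using b T(1) unfolding blocks_def by blast
  qed
next
  assume n: "\<not> contains_simple_spanning (- B) V"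
  show "blocks (SSTs V) B"
    unfolding blocks_def
  proof
    fix T assume "T \<in> SSTs V"
    then have "T \<subseteq> cg_edges V" "simple_graph T" "connected_on V T"
      unfolding SSTs_def spanning_tree_def connected_on_def by (auto simp: Int_absorb2)
    then show "B \<inter> T \<noteq> {}" using n unfolding contains_simple_spanning_def by blast
  qed
qed

text \<open>As long as \<open>S\<close> is not everything, some edge of \<open>T\<close> leaves it;
  adding its outer end costs one vertex and gains at least one edge. With \<open>S\<close> a
  singleton this bounds the edges of a connected graph from below; for general \<open>S\<close> it
  will show that a tree has at most |S| - 1 edges inside \<open>S\<close>.\<close>

lemma connected_on_grow:
  assumes fin: "finite V" and T: "T \<subseteq> cg_edges V" "connected_on V T" and S: "S \<subseteq> V" "S \<noteq> {}"
  shows "card (T \<inter> cg_edges S) + card (V - S) \<le> card T"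
  using S
proof (induction "card (V - S)" arbitrary: S)
  case 0
  then show ?case using fin finite_subset[OF T(1) finite_cg_edges[OF fin]]
    by (simp add: card_mono)
next
  case (Suc n)
  have finT: "finite T" using finite_subset[OF T(1) finite_cg_edges[OF fin]] .
  obtain r where r: "r \<in> S" using Suc.prems by blast
  obtain s where s: "s \<in> V" "s \<notin> S" using Suc.hyps(2)
    by (metis DiffE card_eq_0_iff equals0I nat.distinct(1))
  have "\<exists>x y. x \<in> S \<and> y \<notin> S \<and> {x, y} \<in> T"
  proof (rule ccontr)
    assume no: "\<not> ?thesis"
    have "linked T r s" using connected_on_linked[OF T(2)] r s Suc.prems by blast
    then have "s \<in> S" by (induction rule: linked_induct) (use r no in auto)
    then show False using s by simp
  qed
  then obtain x y where xy: "x \<in> S" "y \<notin> S" "{x, y} \<in> T" by blast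
  then have y: "y \<in> V" using T(1) doubleton_in_cg_edges by blast
  have d: "V - insert y S = (V - S) - {y}" by blast
  have "card (V - S) = Suc (card (V - insert y S))"
    unfolding d using y xy fin by (intro card.remove) auto
  moreover from this have "card (T \<inter> cg_edges (insert y S)) + card (V - insert y S) \<le> card T"
    using Suc y by auto
  moreover have "card (insert {x, y} (T \<inter> cg_edges S)) \<le> card (T \<inter> cg_edges (insert y S))"
    by (intro card_mono) (use finT xy in \<open>auto simp: doubleton_in_cg_edges
        intro: cg_edges_mono[THEN subsetD, of S]\<close>)
  moreover have "{x, y} \<notin> cg_edges S" using xy doubleton_in_cg_edges by blast
  ultimately show ?case using finT by simp
qed

lemma connected_on_card:
  assumes "finite V" "V \<noteq> {}" "T \<subseteq> cg_edges V" "connected_on V T"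
  shows "card V \<le> card T + 1"
proof -
  obtain r where r: "r \<in> V" using assms by blast
  show ?thesis using connected_on_grow[OF assms(1,3,4), of "{r}"] r
    by (simp add: assms(1))
qed

lemma edges_cross_sym: "edges_cross e f \<longleftrightarrow> edges_cross f e"
  unfolding edges_cross_def by (simp add: Int_commute)

text \<open>Every vertex reaches \<open>c\<close> inside its own half, so the shared vertex is a hub
  for the union.\<close>

lemma contains_simple_spanning_join:
  assumes L: "contains_simple_spanning E L" and R: "contains_simple_spanning E R"
    and c: "c \<in> L" "c \<in> R"
    and nc: "\<And>e f. e \<in> cg_edges L \<Longrightarrow> f \<in> cg_edges R \<Longrightarrow> \<not> edges_cross e f"
  shows "contains_simple_spanning E (L \<union> R)"
proof -
  obtain T where T: "T \<subseteq> E \<inter> cg_edges L" "simple_graph T" "connected_on L T"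
    using L unfolding contains_simple_spanning_def by blast
  obtain U where U: "U \<subseteq> E \<inter> cg_edges R" "simple_graph U" "connected_on R U"
    using R unfolding contains_simple_spanning_def by blast
  have sub: "T \<union> U \<subseteq> cg_edges (L \<union> R)" using T(1) U(1) cg_edges_mono[of L "L \<union> R"]
      cg_edges_mono[of R "L \<union> R"] by blast
  have "\<not> edges_cross e f" if "e \<in> T \<union> U" "f \<in> T \<union> U" for e f
    using T U nc[of e f] nc[of f e] that edges_cross_sym[of e f] unfolding simple_graph_def by blast
  then have "simple_graph (T \<union> U)" unfolding simple_graph_def by blast
  moreover have "connected_on (L \<union> R) (T \<union> U)"
  proof (rule linked_hub_imp_connected_on[where r = c])
    fix v assume "v \<in> L \<union> R"
    then show "linked ((T \<union> U) \<inter> cg_edges (L \<union> R)) v c"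
      using connected_on_linked[OF T(3), of v c] connected_on_linked[OF U(3), of v c] c sub
      by (metis Int_absorb2 UnE inf_le1 le_supI1 le_supI2)
  qed
  ultimately show ?thesis using T(1) U(1) sub unfolding contains_simple_spanning_def by blast
qed

text \<open>Directed: V lies to the left, so hull edges run counterclockwise. For two points both
  directions qualify.\<close>

definition hull_edge :: "point set \<Rightarrow> point \<Rightarrow> point \<Rightarrow> bool" where
  "hull_edge V a b \<longleftrightarrow> a \<in> V \<and> b \<in> V \<and> a \<noteq> b \<and> (\<forall>x\<in>V - {a, b}. orient a b x > 0)"

lemma cg_edgesE:
  assumes "e \<in> cg_edges V"
  obtains a b where "e = {a, b}" "a \<in> V" "b \<in> V" "a \<noteq> b"
  using assms unfolding cg_edges_def by blast

text \<open>The line uv itself separates: the edge uv lies on it, and V meets it only in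
  \<open>u\<close> and \<open>v\<close>.\<close>

lemma hull_edge_not_cross:
  assumes "hull_edge V u v" "e \<in> cg_edges V"
  shows "\<not> edges_cross {u, v} e"
proof -
  obtain x y where e: "e = {x, y}" "x \<in> V" "y \<in> V" "x \<noteq> y" using assms(2) by (rule cg_edgesE)
  have pos: "orient u v z \<ge> 0 \<and> (orient u v z = 0 \<longrightarrow> z \<in> {u, v})" if "z \<in> V" for z
  proof (cases "z \<in> {u, v}")
    case False
    then have "orient u v z > 0" using assms(1) that unfolding hull_edge_def by blast
    then show ?thesis by simp
  qed auto
  show ?thesis
    by (rule separated_not_cross[of "{u, v}" u v e x y u v])
      (use assms e pos in \<open>auto simp: hull_edge_def\<close>)
qed

text \<open>Replaces the shared vertex of \<open>contains_simple_spanning_join\<close> by a hull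
  edge between the halves, which no other edge can cross.\<close>

lemma contains_simple_spanning_bridge:
  assumes L: "contains_simple_spanning E L" and R: "contains_simple_spanning E R"
    and uv: "u \<in> L" "v \<in> R" "{u, v} \<in> E" and h: "hull_edge (L \<union> R) u v \<or> hull_edge (L \<union> R) v u"
    and nc: "\<And>e f. e \<in> cg_edges L \<Longrightarrow> f \<in> cg_edges R \<Longrightarrow> \<not> edges_cross e f"
  shows "contains_simple_spanning E (L \<union> R)"
proof -
  obtain T where T: "T \<subseteq> E \<inter> cg_edges L" "simple_graph T" "connected_on L T"
    using L unfolding contains_simple_spanning_def by blast
  obtain U where U: "U \<subseteq> E \<inter> cg_edges R" "simple_graph U" "connected_on R U"
    using R unfolding contains_simple_spanning_def by blast
  let ?W = "insert {u, v} (T \<union> U)"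
  have ne: "u \<noteq> v" using h unfolding hull_edge_def by blast
  have sub: "T \<union> U \<subseteq> cg_edges (L \<union> R)" using T(1) U(1) cg_edges_mono[of L "L \<union> R"]
      cg_edges_mono[of R "L \<union> R"] by blast
  then have subW: "?W \<subseteq> cg_edges (L \<union> R)" using uv ne doubleton_in_cg_edges by auto
  have huv: "\<not> edges_cross {u, v} e" if "e \<in> cg_edges (L \<union> R)" for e
    using h hull_edge_not_cross[OF _ that] by (metis insert_commute)
  have 1: "\<not> edges_cross e f" if "e \<in> T \<union> U" "f \<in> T \<union> U" for e f
    using T U nc[of e f] nc[of f e] that edges_cross_sym[of e f] unfolding simple_graph_def by blast
  have "\<not> edges_cross e f" if "e \<in> ?W" "f \<in> ?W" for e f
    using 1[of e f] huv[of e] huv[of f] subW that edges_cross_sym[of e f] by blast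
  then have "simple_graph ?W" unfolding simple_graph_def by blast
  moreover have "connected_on (L \<union> R) ?W"
  proof (rule linked_hub_imp_connected_on[where r = u])
    fix w assume w: "w \<in> L \<union> R"
    have vu: "linked ?W v u" using linked_edge[of v u ?W] by (simp add: insert_commute)
    have "linked ?W w u"
    proof (cases "w \<in> L")
      case True then show ?thesis using connected_on_linked[OF T(3), of w u ?W] uv by blast
    next
      case False
      then have "linked ?W w v" using connected_on_linked[OF U(3), of w v ?W] uv w by blast
      then show ?thesis using vu linked_trans by blast
    qed
    then show "linked (?W \<inter> cg_edges (L \<union> R)) w u" using subW by (simp add: Int_absorb2)
  qed
  moreover have "?W \<subseteq> E \<inter> cg_edges (L \<union> R)" using T(1) U(1) uv subW by blast
  ultimately show ?thesis unfolding contains_simple_spanning_def by blast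
qed

lemma contains_simple_spanning_singleton [simp]: "contains_simple_spanning E {v}"
  unfolding contains_simple_spanning_def connected_on_def simple_graph_def
  by (rule exI[of _ "{}"]) simp

lemma cg_edges_singleton [simp]: "cg_edges {v} = {}"
  unfolding cg_edges_def by auto

text \<open>The bridge with one half a single vertex. Read backwards for the complement of
  \<open>B\<close>: if the hull edge uv is missing from \<open>B\<close>, then blocking V implies
  blocking \<open>V - {v}\<close>.\<close>

lemma contains_simple_spanning_extend:
  assumes "contains_simple_spanning E (V - {v})" "{u, v} \<in> E" "hull_edge V u v \<or> hull_edge V v u"
  shows "contains_simple_spanning E V"
proof -
  have V: "V - {v} \<union> {v} = V" "u \<in> V - {v}" using assms(3) unfolding hull_edge_def by auto
  show ?thesis
    using contains_simple_spanning_bridge[of E "V - {v}" "{v}" u v] assms V by simp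
qed

lemma contains_simple_spanning_pair:
  assumes "{u, v} \<in> E" "u \<noteq> v"
  shows "contains_simple_spanning E {u, v}"
proof -
  have "{u, v} - {v} = {u}" using assms by auto
  then show ?thesis using contains_simple_spanning_extend[of E "{u, v}" v u] assms
    by (simp add: hull_edge_def)
qed

lemma split_line_not_cross:
  assumes "\<And>x. x \<in> L \<Longrightarrow> orient p q x \<le> 0" "\<And>x. x \<in> R \<Longrightarrow> orient p q x \<ge> 0"
    and "\<And>x. x \<in> L \<union> R \<Longrightarrow> orient p q x = 0 \<Longrightarrow> x \<in> {p, q}"
    and "e \<in> cg_edges L" "f \<in> cg_edges R"
  shows "\<not> edges_cross e f"
proof -
  obtain x y where e: "e = {x, y}" "x \<in> L" "y \<in> L" "x \<noteq> y" using assms(4) by (rule cg_edgesE)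
  obtain z w where f: "f = {z, w}" "z \<in> R" "w \<in> R" "z \<noteq> w" using assms(5) by (rule cg_edgesE)
  show ?thesis
    by (rule separated_not_cross[of e x y f z w p q]) (use assms e f in auto)
qed

section \<open>Monochromatic simple spanning trees\<close>

text \<open>\<open>W\<close> lies in an open half-plane bounded by a line through \<open>v\<close>.
  There \<open>h\<close> and \<open>k\<close> are the dot and cross products with the normal (m, n),
  and \<open>k x / h x\<close> is the tangent of the angle from it, which increases
  counterclockwise. A real key makes first and last vertices available as minima and maxima.\<close>

lemma angular_key:
  assumes "\<And>x. x \<in> W \<Longrightarrow> m * (x$1 - v$1) + n * (x$2 - v$2) > 0"
  obtains key :: "point \<Rightarrow> real"
  where "\<And>x y. x \<in> W \<Longrightarrow> y \<in> W \<Longrightarrow> orient v x y > 0 \<longleftrightarrow> key x < key y"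
proof -
  define h where "h x = m * (x$1 - v$1) + n * (x$2 - v$2)" for x :: point
  define k where "k x = m * (x$2 - v$2) - n * (x$1 - v$1)" for x :: point
  have "orient v x y > 0 \<longleftrightarrow> k x / h x < k y / h y" if "x \<in> W" "y \<in> W" for x y
  proof -
    have pos: "h x > 0" "h y > 0" using assms that by (auto simp: h_def)
    then have mn: "m\<^sup>2 + n\<^sup>2 > 0"
      by (auto simp: h_def sum_power2_gt_zero_iff)
    have "(m\<^sup>2 + n\<^sup>2) * orient v x y = k y * h x - k x * h y"
      unfolding h_def k_def orient_def by algebra
    moreover have "orient v x y > 0 \<longleftrightarrow> (m\<^sup>2 + n\<^sup>2) * orient v x y > 0"
      using mn by (simp add: zero_less_mult_iff)
    moreover have "k x / h x < k y / h y \<longleftrightarrow> k y * h x - k x * h y > 0"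
      using pos by (simp add: divide_less_eq less_divide_eq field_simps)
    ultimately show ?thesis by simp
  qed
  then show ?thesis by (rule that)
qed

lemma ex_arg_min:
  fixes f :: "'a \<Rightarrow> real"
  assumes "finite A" "A \<noteq> {}"
  obtains x where "x \<in> A" "\<And>y. y \<in> A \<Longrightarrow> f x \<le> f y"
  using arg_min_least[OF assms, of _ f] arg_min_if_finite(1)[OF assms, of f] by blast

lemma ex_arg_max:
  fixes f :: "'a \<Rightarrow> real"
  assumes "finite A" "A \<noteq> {}"
  obtains x where "x \<in> A" "\<And>y. y \<in> A \<Longrightarrow> f y \<le> f x"
  using ex_arg_min[OF assms, of "\<lambda>x. - f x"] by auto

lemma key_inj:
  assumes "general_position V" "v \<in> V" "W \<subseteq> V - {v}"
    and "\<And>x y. x \<in> W \<Longrightarrow> y \<in> W \<Longrightarrow> orient v x y > 0 \<longleftrightarrow> key x < (key y :: real)"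
    and "x \<in> W" "y \<in> W" "x \<noteq> y"
  shows "key x \<noteq> key y"
proof -
  have "orient v x y \<noteq> 0" using general_position_orient[OF assms(1), of v x y] assms by blast
  then have "orient v x y > 0 \<or> orient v y x > 0" using orient_swap[of v x y] by linarith
  then show ?thesis using assms(4)[of x y] assms(4)[of y x] assms(5,6) by auto
qed

section \<open>Hull neighbours and extreme points\<close>

text \<open>Gift wrapping: all other vertices lie left of ab, so they are angularly ordered around
  \<open>b\<close>, and the first of them has the rest on its left. If there are none, the reversed
  edge is the successor.\<close>

lemma hull_edge_successor:
  assumes gp: "general_position V" and h: "hull_edge V a b"
  shows "\<exists>c. hull_edge V b c"
proof (cases "V - {a, b} = {}")
  case True
  then show ?thesis using h by (intro exI[of _ a]) (auto simp: hull_edge_def)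
next
  case False
  let ?W = "V - {a, b}"
  \<comment> \<open>The normal of ab serves as the vector (m, n) of
    \<open>angular_key\<close>.\<close>
  have "- (b$2 - a$2) * (x$1 - b$1) + (b$1 - a$1) * (x$2 - b$2) = orient a b x" for x
    unfolding orient_def by algebra
  then obtain key :: "point \<Rightarrow> real"
    where key: "\<And>x y. x \<in> ?W \<Longrightarrow> y \<in> ?W \<Longrightarrow> orient b x y > 0 \<longleftrightarrow> key x < key y"
    using angular_key[of ?W "- (b$2 - a$2)" b "b$1 - a$1"] h unfolding hull_edge_def by metis
  have fin: "finite ?W" using gp unfolding general_position_def by blast
  obtain c where c: "c \<in> ?W" "\<And>y. y \<in> ?W \<Longrightarrow> key c \<le> key y" using ex_arg_min[OF fin False] by blast
  have "orient b c x > 0" if "x \<in> V - {b, c}" for x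
  proof (cases "x = a")
    case True
    have "orient a b c > 0" using h c(1) unfolding hull_edge_def by blast
    then show ?thesis using True orient_rotate[of a b c] by simp
  next
    case False
    then have x: "x \<in> ?W" "c \<noteq> x" using that by auto
    have "key c \<noteq> key x"
      by (rule key_inj[where key = key, OF gp _ _ key c(1) x])
        (use h in \<open>auto simp: hull_edge_def\<close>)
    then show ?thesis using key[OF c(1) x(1)] c(2)[OF x(1)] by simp
  qed
  then show ?thesis using h c(1) unfolding hull_edge_def by blast
qed

text \<open>The same around \<open>a\<close>, with the last vertex of the angular order.\<close>

lemma hull_edge_predecessor:
  assumes gp: "general_position V" and h: "hull_edge V a b"
  shows "\<exists>c. hull_edge V c a"
proof (cases "V - {a, b} = {}")
  case True
  then show ?thesis using h by (intro exI[of _ b]) (auto simp: hull_edge_def)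
next
  case False
  let ?W = "V - {a, b}"
  have "- (b$2 - a$2) * (x$1 - a$1) + (b$1 - a$1) * (x$2 - a$2) = orient a b x" for x
    unfolding orient_def by algebra
  then obtain key :: "point \<Rightarrow> real"
    where key: "\<And>x y. x \<in> ?W \<Longrightarrow> y \<in> ?W \<Longrightarrow> orient a x y > 0 \<longleftrightarrow> key x < key y"
    using angular_key[of ?W "- (b$2 - a$2)" a "b$1 - a$1"] h unfolding hull_edge_def by metis
  have fin: "finite ?W" using gp unfolding general_position_def by blast
  obtain c where c: "c \<in> ?W" "\<And>y. y \<in> ?W \<Longrightarrow> key y \<le> key c" using ex_arg_max[OF fin False] by blast
  have "orient c a x > 0" if "x \<in> V - {c, a}" for x
  proof (cases "x = b")
    case True
    have "orient a b c > 0" using h c(1) unfolding hull_edge_def by blast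
    then show ?thesis using True orient_rotate[of c a b] by simp
  next
    case False
    then have x: "x \<in> ?W" "x \<noteq> c" using that by auto
    have "key x \<noteq> key c"
      by (rule key_inj[where key = key, OF gp _ _ key x(1) c(1) x(2)])
        (use h in \<open>auto simp: hull_edge_def\<close>)
    then have "orient a x c > 0" using key[OF x(1) c(1)] c(2)[OF x(1)] by simp
    then show ?thesis using orient_rotate[of c a x] by simp
  qed
  then show ?thesis using h c(1) unfolding hull_edge_def by blast
qed

text \<open>\<open>v\<close> is a vertex farthest from the origin and (m, n) is -v: the tangent at
  \<open>v\<close> to the circle through \<open>v\<close> around the origin has all other vertices
  strictly on its inner side.\<close>

lemma ex_extreme_point:
  assumes "finite V" "V \<noteq> {}"
  obtains v :: point and m n :: real
  where "v \<in> V" "\<And>x. x \<in> V - {v} \<Longrightarrow> m * (x$1 - v$1) + n * (x$2 - v$2) > 0"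
proof -
  obtain v :: point where v: "v \<in> V"
    "\<And>x. x \<in> V \<Longrightarrow> (x$1)\<^sup>2 + (x$2)\<^sup>2 \<le> (v$1)\<^sup>2 + (v$2)\<^sup>2"
    using ex_arg_max[OF assms, of "\<lambda>x. (x$1)\<^sup>2 + (x$2)\<^sup>2"] by blast
  have "- (v$1) * (x$1 - v$1) + - (v$2) * (x$2 - v$2) > 0" if "x \<in> V - {v}" for x
  proof -
    have "x$1 - v$1 \<noteq> 0 \<or> x$2 - v$2 \<noteq> 0" using that by (auto simp: vec_eq_iff forall_2)
    then have "(x$1 - v$1)\<^sup>2 + (x$2 - v$2)\<^sup>2 > 0" by (simp add: sum_power2_gt_zero_iff)
    moreover have "2 * (- (v$1) * (x$1 - v$1) + - (v$2) * (x$2 - v$2))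
        = (x$1 - v$1)\<^sup>2 + (x$2 - v$2)\<^sup>2 + ((v$1)\<^sup>2 + (v$2)\<^sup>2) - ((x$1)\<^sup>2 + (x$2)\<^sup>2)"
      by algebra
    ultimately show ?thesis using v(2)[of x] that by auto
  qed
  then show ?thesis using that v(1) by blast
qed

text \<open>The first and last vertices in the angular order around an extreme point are its two
  hull neighbours.\<close>

lemma extreme_fan:
  assumes gp: "general_position V" and card: "card V \<ge> 2"
  shows "\<exists>v key a z. v \<in> V \<and>
    (\<forall>x\<in>V - {v}. \<forall>y\<in>V - {v}. orient v x y > 0 \<longleftrightarrow> key x < (key y :: real)) \<and>
    a \<in> V - {v} \<and> (\<forall>y\<in>V - {v}. key a \<le> key y) \<and> hull_edge V v a \<and>
    z \<in> V - {v} \<and> (\<forall>y\<in>V - {v}. key y \<le> key z) \<and> hull_edge V z v"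
proof -
  have fin: "finite V" using gp unfolding general_position_def by blast
  have "V \<noteq> {}" using card by auto
  then obtain v m n where v: "v \<in> V" "\<And>x. x \<in> V - {v} \<Longrightarrow> m * (x$1 - v$1) + n * (x$2 - v$2) > 0"
    using ex_extreme_point[OF fin] by blast
  define W where "W = V - {v}"
  obtain key :: "point \<Rightarrow> real"
    where key: "\<And>x y. x \<in> W \<Longrightarrow> y \<in> W \<Longrightarrow> orient v x y > 0 \<longleftrightarrow> key x < key y"
    using angular_key[OF v(2)] unfolding W_def by metis
  have inj: "key x \<noteq> key y" if "x \<in> W" "y \<in> W" "x \<noteq> y" for x y
    by (rule key_inj[OF gp v(1) _ key that]) (use W_def in auto)
  have "card W \<ge> 1" using card v(1) fin by (simp add: W_def)
  then have W: "W \<noteq> {}" by auto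
  have finW: "finite W" using fin W_def by simp
  obtain a where a: "a \<in> W" "\<And>y. y \<in> W \<Longrightarrow> key a \<le> key y" using ex_arg_min[OF finW W] by blast
  obtain z where z: "z \<in> W" "\<And>y. y \<in> W \<Longrightarrow> key y \<le> key z" using ex_arg_max[OF finW W] by blast
  have va: "hull_edge V v a"
    unfolding hull_edge_def using v(1) a key[OF a(1)] inj[OF a(1)] by (force simp: W_def)
  have "orient z v x > 0" if "x \<in> V - {z, v}" for x
    using key[of x z] z inj[of x z] that orient_rotate[of z v x] by (force simp: W_def)
  then have zv: "hull_edge V z v" unfolding hull_edge_def using v(1) z by (force simp: W_def)
  show ?thesis
    using v(1) key a z va zv unfolding W_def
    by (intro exI[of _ v] exI[of _ key] exI[of _ a] exI[of _ z]) simp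
qed

lemma ex_hull_edge:
  assumes "general_position V" "card V \<ge> 2"
  shows "\<exists>a b. hull_edge V a b"
  using extreme_fan[OF assms] by blast

text \<open>Sweep around the extreme point v: take the longest initial fan \<open>L q\<close> coloured E and the next
  vertex p. The final fan \<open>R p\<close> is coloured E and joins \<open>L q\<close> at v, or it is coloured F and joins
  \<open>L p\<close>, which must be coloured F by maximality.\<close>
lemma monochromatic_fan:
  assumes gp: "general_position V" and v: "v \<in> V" and W: "W = V - {v}"
    and key: "\<And>x y. x \<in> W \<Longrightarrow> y \<in> W \<Longrightarrow> orient v x y > 0 \<longleftrightarrow> key x < (key y :: real)"
    and a: "a \<in> W" "\<And>y. y \<in> W \<Longrightarrow> key a \<le> key y" "{v, a} \<in> E"
    and z: "z \<in> W" "\<And>y. y \<in> W \<Longrightarrow> key y \<le> key z" "{v, z} \<in> E"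
    and az: "a \<noteq> z"
    and IH: "\<And>S. S \<subset> V \<Longrightarrow> S \<noteq> {} \<Longrightarrow>
      contains_simple_spanning E S \<or> contains_simple_spanning F S"
  shows "contains_simple_spanning E V \<or> contains_simple_spanning F V"
proof -
  define L where "L q = insert v {x \<in> W. key x \<le> key q}" for q
  define R where "R q = insert v {x \<in> W. key x \<ge> key q}" for q
  have finW: "finite W" using gp W unfolding general_position_def by blast
  have inj: "key x \<noteq> key y" if "x \<in> W" "y \<in> W" "x \<noteq> y" for x y
    by (rule key_inj[OF gp v _ key that]) (use W in auto)
  have vE: "contains_simple_spanning E {v, a}" "contains_simple_spanning E {v, z}"
    using contains_simple_spanning_pair a(1,3) z(1,3) W by auto
  have La: "L a = {v, a}" unfolding L_def using a(1,2) inj[of a] by force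
  have Rz: "R z = {v, z}" unfolding R_def using z(1,2) inj[of z] by force
  \<comment> \<open>The line vq separates the two fans, and \<open>v\<close> and \<open>q\<close>
    are the only vertices on it.\<close>
  have nc: "\<not> edges_cross e f" if q: "q \<in> W" and ef: "e \<in> cg_edges (L q)" "f \<in> cg_edges (R q)" for q e f
  proof (rule split_line_not_cross[OF _ _ _ ef, of v q])
    show "orient v q x \<le> 0" if "x \<in> L q" for x
      using that key[OF q, of x] unfolding L_def by force
    show "orient v q x \<ge> 0" if "x \<in> R q" for x
      using that key[of x q] q orient_swap[of v x q] unfolding R_def by force
    show "x \<in> {v, q}" if "x \<in> L q \<union> R q" "orient v q x = 0" for x
      using general_position_orient[OF gp v, of q x] that q W unfolding L_def R_def by auto
  qed
  define S where "S = {q \<in> W. contains_simple_spanning E (L q)}"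
  have "a \<in> S" unfolding S_def using a(1) La vE by simp
  moreover have "finite S" unfolding S_def using finW by simp
  ultimately obtain q where q: "q \<in> S" "\<And>y. y \<in> S \<Longrightarrow> key y \<le> key q" using ex_arg_max by blast
  have qW: "q \<in> W" and Lq: "contains_simple_spanning E (L q)" using q(1) unfolding S_def by auto
  show ?thesis
  proof (cases "q = z")
    case True
    then have "L q = V" unfolding L_def using z W v by auto
    then show ?thesis using Lq by simp
  next
    case False
    let ?Q = "{x \<in> W. key x > key q}"
    have "z \<in> ?Q" using inj[OF qW z(1) False] z qW by force
    moreover have "finite ?Q" using finW by simp
    ultimately obtain p where p: "p \<in> ?Q" "\<And>y. y \<in> ?Q \<Longrightarrow> key p \<le> key y"
      using ex_arg_min[of ?Q key] by blast
    have pW: "p \<in> W" and qp: "key q < key p" using p(1) by auto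
    have LR: "L q \<union> R p = V" unfolding L_def R_def using p(2) v W by force
    have "L p \<union> R p = V" unfolding L_def R_def using v W by force
    have Lsub: "L q \<subseteq> L p" unfolding L_def using qp by auto
    have "a \<notin> R p" unfolding R_def using a W qp qW by force
    then have "R p \<subset> V" using a(1) W LR by blast
    moreover have "R p \<noteq> {}" unfolding R_def by blast
    ultimately have Rp: "contains_simple_spanning E (R p) \<or> contains_simple_spanning F (R p)"
      using IH by blast
    have ER: "contains_simple_spanning E V" if "contains_simple_spanning E (R p)"
      using contains_simple_spanning_join[OF Lq that, of v] nc[OF pW] cg_edges_mono[OF Lsub] LR
      unfolding L_def R_def by blast
    show ?thesis
    proof (cases "p = z")
      case True
      then show ?thesis using ER Rz vE by simp
    next
      case False
      then have "z \<notin> L p" unfolding L_def using inj[OF pW z(1) False] z W pW by force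
      then have "L p \<subset> V" using z(1) W \<open>L p \<union> R p = V\<close> by blast
      moreover have "L p \<noteq> {}" unfolding L_def by blast
      moreover have "\<not> contains_simple_spanning E (L p)" using q(2)[of p] pW qp unfolding S_def by force
      ultimately have LpF: "contains_simple_spanning F (L p)" using IH by blast
      have "contains_simple_spanning F V" if "contains_simple_spanning F (R p)"
        using contains_simple_spanning_join[OF LpF that, of v] nc[OF pW] \<open>L p \<union> R p = V\<close>
        unfolding L_def R_def by simp
      then show ?thesis using ER Rp by blast
    qed
  qed
qed

text \<open>If the two hull edges at the extreme vertex \<open>v\<close> have different colours,
  then whichever colour spans \<open>V - {v}\<close> is extended by the hull edge of that colour. If
  they have the same colour, \<open>monochromatic_fan\<close> applies.\<close>

theorem monochromatic_simple_spanning: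
  assumes "general_position V" "V \<noteq> {}"
  shows "contains_simple_spanning B V \<or> contains_simple_spanning (- B) V"
  using assms
proof (induction "card V" arbitrary: V rule: less_induct)
  case less
  have fin: "finite V" using less.prems unfolding general_position_def by blast
  have IH: "contains_simple_spanning B S \<or> contains_simple_spanning (- B) S" if "S \<subset> V" "S \<noteq> {}" for S
    using less.hyps[of S] that less.prems(1) general_position_subset[of V S] psubset_card_mono[OF fin, of S]
    by blast
  show ?case
  proof (cases "card V \<ge> 2")
    case False
    then have "card V = 1" using fin less.prems(2) by (cases "card V") auto
    then obtain v where "V = {v}" by (auto simp: card_1_singleton_iff)
    then show ?thesis by simp
  next
    case True
    obtain v a z and key :: "point \<Rightarrow> real" where v: "v \<in> V"
      and key: "\<forall>x\<in>V - {v}. \<forall>y\<in>V - {v}. orient v x y > 0 \<longleftrightarrow> key x < key y"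
      and a: "a \<in> V - {v}" "\<forall>y\<in>V - {v}. key a \<le> key y" and va: "hull_edge V v a"
      and z: "z \<in> V - {v}" "\<forall>y\<in>V - {v}. key y \<le> key z" and zv: "hull_edge V z v"
      using extreme_fan[OF less.prems(1) True] by (elim exE conjE)
    let ?W = "V - {v}"
    have Wp: "?W \<subset> V" "?W \<noteq> {}" using v a by blast+
    consider "a = z" | "a \<noteq> z" "{v, a} \<in> B" "{v, z} \<in> B" | "a \<noteq> z" "{v, a} \<notin> B" "{v, z} \<notin> B"
      | "{v, a} \<in> B \<longleftrightarrow> {v, z} \<notin> B" by blast
    then show ?thesis
    proof cases
      case 1
      have "V = {v, a}"
      proof (rule ccontr)
        assume "V \<noteq> {v, a}"
        then obtain x where "x \<in> V - {v, a}" using v a by blast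
        then have "orient v a x > 0" "orient a v x > 0"
          using va zv 1 unfolding hull_edge_def by auto
        then show False using orient_flip[of v a x] by simp
      qed
      then show ?thesis
        using contains_simple_spanning_pair[of v a B] contains_simple_spanning_pair[of v a "- B"] a(1)
        by blast
    next
      case 2
      then show ?thesis
        using monochromatic_fan[OF less.prems(1) v refl key[rule_format] a(1) a(2)[rule_format] _ z(1) z(2)[rule_format], of B "- B"] IH by blast
    next
      case 3
      then show ?thesis
        using monochromatic_fan[OF less.prems(1) v refl key[rule_format] a(1) a(2)[rule_format] _ z(1) z(2)[rule_format], of "- B" "B"] IH by blast
    next
      case 4
      have "contains_simple_spanning E V" if "contains_simple_spanning E ?W" "E = B \<or> E = - B" for E
      proof (cases "{v, a} \<in> E")
        case True
        then show ?thesis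
          using contains_simple_spanning_extend[of E V v a] that va by (simp add: insert_commute)
      next
        case False
        then have "{z, v} \<in> E" using 4 that(2) by (auto simp: insert_commute)
        then show ?thesis
          using contains_simple_spanning_extend[of E V v z] that zv by (simp add: insert_commute)
      qed
      then show ?thesis using IH[OF Wp] by blast
    qed
  qed
qed

section \<open>Tight blockers\<close>

definition leaf :: "edge set \<Rightarrow> point \<Rightarrow> bool" where
  "leaf B v \<longleftrightarrow> (\<exists>!e. e \<in> B \<and> v \<in> e)"

text \<open>Fixing the size to |V| - 1, which turns out to be the minimum, avoids comparison with
  other blocking sets, so the notion is easily passed on to V minus a vertex in an
  induction.\<close>

definition tight_blocker :: "point set \<Rightarrow> edge set \<Rightarrow> bool" where
  "tight_blocker V B \<longleftrightarrow> B \<subseteq> cg_edges V \<and> \<not> contains_simple_spanning (- B) V \<and> card B + 1 = card V"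

lemma general_position_finite: "general_position V \<Longrightarrow> finite V"
  unfolding general_position_def by blast

text \<open>The form in which the colouring theorem is used: a vertex set not spanned by the
  complement is spanned by \<open>B\<close>.\<close>

lemma connected_on_of_blocking:
  assumes "general_position V" "S \<subseteq> V" "S \<noteq> {}" "\<not> contains_simple_spanning (- B) S"
  shows "connected_on S B"
proof -
  have "contains_simple_spanning B S"
    using monochromatic_simple_spanning[of S B] general_position_subset[OF assms(1,2)] assms(3,4) by blast
  then obtain T where T: "T \<subseteq> B \<inter> cg_edges S" "connected_on S T"
    unfolding contains_simple_spanning_def by blast
  from T(2) show ?thesis by (rule connected_on_mono) (use T(1) in blast)
qed

lemma tight_blocker_nonempty:
  assumes "tight_blocker V B"
  shows "V \<noteq> {}"
  using assms unfolding tight_blocker_def by auto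

text \<open>\<open>B\<close> contains a connected simple graph on V; that graph already needs |V| -
  1 edges and so is all of \<open>B\<close>.\<close>

lemma tight_blocker_tree:
  assumes gp: "general_position V" and t: "tight_blocker V B"
  shows "connected_on V B" "simple_graph B"
proof -
  have fin: "finite V" by (rule general_position_finite[OF gp])
  have sub: "B \<subseteq> cg_edges V" and c: "card B + 1 = card V" using t unfolding tight_blocker_def by auto
  have finB: "finite B" using finite_subset[OF sub finite_cg_edges[OF fin]] .
  have "contains_simple_spanning B V"
    using monochromatic_simple_spanning[OF gp tight_blocker_nonempty[OF t], of B] t
    unfolding tight_blocker_def by blast
  then obtain T where T: "T \<subseteq> B \<inter> cg_edges V" "simple_graph T" "connected_on V T"
    unfolding contains_simple_spanning_def by blast
  have "card V \<le> card T + 1"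
    using connected_on_card[OF fin tight_blocker_nonempty[OF t] _ T(3)] T(1) by blast
  then have "card B \<le> card T" using c by simp
  then have "T = B" using card_seteq[OF finB, of T] T(1) by blast
  then show "connected_on V B" "simple_graph B" using T by auto
qed

lemma tight_blocker_card_subset:
  assumes "general_position V" "tight_blocker V B" "S \<subseteq> V" "S \<noteq> {}"
  shows "card (B \<inter> cg_edges S) + 1 \<le> card S"
proof -
  have fin: "finite V" by (rule general_position_finite[OF assms(1)])
  have "card (B \<inter> cg_edges S) + card (V - S) \<le> card B"
    using connected_on_grow[OF fin _ _ assms(3,4)] assms(1,2) tight_blocker_tree(1)
    unfolding tight_blocker_def by blast
  moreover have "card V = card S + card (V - S)"
    using assms(3) fin by (metis card_Diff_subset card_mono finite_subset le_add_diff_inverse)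
  ultimately show ?thesis using assms(2) unfolding tight_blocker_def by linarith
qed

lemma tight_blocker_acyclic:
  assumes gp: "general_position V" and t: "tight_blocker V B" and ab: "{a, b} \<in> B"
  shows "\<not> linked (B - {{a, b}}) a b"
proof
  assume l: "linked (B - {{a, b}}) a b"
  have fin: "finite V" by (rule general_position_finite[OF gp])
  have sub: "B \<subseteq> cg_edges V" and c: "card B + 1 = card V" using t unfolding tight_blocker_def by auto
  have finB: "finite B" using finite_subset[OF sub finite_cg_edges[OF fin]] .
  have i: "B \<inter> cg_edges V = B" "(B - {{a, b}}) \<inter> cg_edges V = B - {{a, b}}" using sub by blast+
  have "connected_on V (B - {{a, b}})"
    using tight_blocker_tree(1)[OF gp t] linked_remove_cycle_edge[OF l] i
    unfolding connected_on_def by simp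
  then have "card V \<le> card (B - {{a, b}}) + 1"
    using connected_on_card[OF fin tight_blocker_nonempty[OF t]] sub by blast
  then show False using c card_Diff1_less[OF finB ab] by simp
qed

text \<open>If all hull edges were in \<open>B\<close>, mapping a hull vertex to the edge to its
  successor would give |H| edges inside \<open>H\<close>, one too many for a tree. The map is
  injective because a pair that is a hull edge in both directions forces V to have two
  points.\<close>

lemma ex_hull_edge_not_in_blocker:
  assumes gp: "general_position V" and t: "tight_blocker V B" and c3: "card V \<ge> 3"
  shows "\<exists>u v. hull_edge V u v \<and> {u, v} \<notin> B"
proof (rule ccontr)
  assume "\<not> ?thesis"
  then have all: "\<And>u v. hull_edge V u v \<Longrightarrow> {u, v} \<in> B" by blast
  define H where "H = {a. \<exists>b. hull_edge V a b}"
  define s where "s a = (SOME b. hull_edge V a b)" for a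
  have s: "hull_edge V a (s a)" if "a \<in> H" for a
    using that someI_ex[of "hull_edge V a"] unfolding H_def s_def by blast
  have sH: "s a \<in> H" if "a \<in> H" for a
    using hull_edge_successor[OF gp s[OF that]] unfolding H_def by blast
  have HV: "H \<subseteq> V" unfolding H_def hull_edge_def by blast
  have fin: "finite V" by (rule general_position_finite[OF gp])
  have finB: "finite B" using finite_subset[OF _ finite_cg_edges[OF fin]] t
    unfolding tight_blocker_def by blast
  have "inj_on (\<lambda>a. {a, s a}) H"
  proof (rule inj_onI, rule ccontr)
    fix a b assume ab: "a \<in> H" "b \<in> H" "{a, s a} = {b, s b}" "a \<noteq> b"
    then have "s a = b" "s b = a" by (auto simp: doubleton_eq_iff)
    then have h: "hull_edge V a b" "hull_edge V b a" using s[OF ab(1)] s[OF ab(2)] by simp_all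
    have "card {a, b} = 2" using ab(4) by simp
    then have "V \<noteq> {a, b}" using c3 by auto
    then obtain x where "x \<in> V - {a, b}" using h unfolding hull_edge_def by blast
    then have "orient a b x > 0" "orient b a x > 0" using h unfolding hull_edge_def by auto
    then show False using orient_flip[of a b x] by simp
  qed
  moreover have "(\<lambda>a. {a, s a}) ` H \<subseteq> B \<inter> cg_edges H"
  proof
    fix e assume "e \<in> (\<lambda>a. {a, s a}) ` H"
    then obtain a where a: "a \<in> H" "e = {a, s a}" by blast
    moreover have "a \<noteq> s a" using s[OF a(1)] unfolding hull_edge_def by blast
    ultimately show "e \<in> B \<inter> cg_edges H" using s[OF a(1)] sH[OF a(1)] all cg_edgesI by simp
  qed
  ultimately have "card H \<le> card (B \<inter> cg_edges H)"
    by (intro card_inj_on_le) (use finB in auto)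
  moreover have "H \<noteq> {}" using ex_hull_edge[OF gp] c3 unfolding H_def by auto
  ultimately show False using tight_blocker_card_subset[OF gp t HV] by linarith
qed

lemma connected_on_ex_edge:
  assumes "connected_on V B" "u \<in> V" "v \<in> V" "u \<noteq> v"
  shows "\<exists>w. {u, w} \<in> B \<inter> cg_edges V"
proof (rule ccontr)
  assume no: "\<not> ?thesis"
  have "linked (B \<inter> cg_edges V) u v" using assms unfolding connected_on_def by blast
  then have "v = u" by (induction rule: linked_induct) (use no in auto)
  then show False using assms by simp
qed

text \<open>Since uv is missing, \<open>B\<close> still blocks \<open>V - {u}\<close>, so it is
  connected there and has at least |V| - 2 edges avoiding \<open>u\<close>. At most one edge remains
  for \<open>u\<close>, and connectivity of \<open>B\<close> requires one.\<close>

lemma tight_blocker_delete: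
  assumes gp: "general_position V" and t: "tight_blocker V B"
    and h: "hull_edge V u v \<or> hull_edge V v u" and nB: "{u, v} \<notin> B"
  shows "leaf B u" "tight_blocker (V - {u}) (B \<inter> cg_edges (V - {u}))"
proof -
  let ?W = "V - {u}" and ?D = "{e \<in> B. u \<in> e}"
  let ?B = "B \<inter> cg_edges ?W"
  have fin: "finite V" by (rule general_position_finite[OF gp])
  have sub: "B \<subseteq> cg_edges V" and c: "card B + 1 = card V" and bl: "\<not> contains_simple_spanning (- B) V"
    using t unfolding tight_blocker_def by auto
  have finB: "finite B" using finite_subset[OF sub finite_cg_edges[OF fin]] .
  have uv: "u \<in> V" "v \<in> V" "u \<noteq> v" using h unfolding hull_edge_def by auto
  have W: "?W \<noteq> {}" "?W \<subseteq> V" using uv by blast+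
  have "\<not> contains_simple_spanning (- B) ?W"
    using contains_simple_spanning_extend[of "- B" V u v] h nB bl by (auto simp: insert_commute)
  moreover have "contains_simple_spanning (- ?B) ?W \<Longrightarrow> contains_simple_spanning (- B) ?W"
  proof -
    have eq: "- ?B \<inter> cg_edges ?W = - B \<inter> cg_edges ?W" by blast
    show "contains_simple_spanning (- ?B) ?W \<Longrightarrow> contains_simple_spanning (- B) ?W"
      unfolding contains_simple_spanning_def by (simp only: eq)
  qed
  ultimately have nb: "\<not> contains_simple_spanning (- ?B) ?W" and con: "connected_on ?W B"
    using connected_on_of_blocking[OF gp W(2,1)] by blast+
  then have con': "connected_on ?W ?B" unfolding connected_on_def by (simp add: Int_assoc)
  have "card ?W \<le> card ?B + 1"
    using connected_on_card[OF _ W(1) _ con'] fin by blast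
  moreover have "card V = card ?W + 1" using card_Suc_Diff1[OF fin uv(1)] by simp
  moreover have "card B = card ?B + card ?D"
  proof -
    have "e \<in> cg_edges ?W \<longleftrightarrow> u \<notin> e" if e: "e \<in> B" for e
    proof -
      obtain x y where "e = {x, y}" "x \<in> V" "y \<in> V" "x \<noteq> y"
        using subsetD[OF sub e] by (rule cg_edgesE)
      then show ?thesis by (auto simp: doubleton_in_cg_edges)
    qed
    then have "B - cg_edges ?W = ?D" by blast
    then show ?thesis using card_Int_Diff[OF finB, of "cg_edges ?W"] by simp
  qed
  moreover have "card ?D \<noteq> 0"
  proof -
    have "?D \<noteq> {}" using connected_on_ex_edge[OF tight_blocker_tree(1)[OF gp t] uv] by blast
    then show ?thesis using finB by simp
  qed
  ultimately have cD: "card ?D = 1" and cB: "card ?B + 1 = card ?W" using c by linarith+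
  obtain e where e: "?D = {e}" using cD card_1_singletonE by blast
  have "x \<in> ?D \<longleftrightarrow> x = e" for x unfolding e by simp
  then show "leaf B u" unfolding leaf_def by simp
  show "tight_blocker ?W ?B" unfolding tight_blocker_def using nb cB by blast
qed

section \<open>Splitting the vertices along a line\<close>

definition side :: "point set \<Rightarrow> point \<Rightarrow> point \<Rightarrow> point set" where
  "side V a b = {x \<in> V. orient a b x > 0}"

lemma side_disjoint: "a \<notin> side V a b" "b \<notin> side V a b" "side V a b \<subseteq> V"
  unfolding side_def by auto

lemma side_cases:
  assumes "general_position V" "a \<in> V" "b \<in> V" "a \<noteq> b"
  shows "V = side V a b \<union> side V b a \<union> {a, b}"
  using general_position_orient[OF assms(1-3)] assms orient_flip[of a b]
  unfolding side_def by force

lemma side_not_cross: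
  assumes gp: "general_position V" and ab: "a \<in> V" "b \<in> V" "a \<noteq> b"
    and XY: "X \<subseteq> {a, b}" "Y \<subseteq> {a, b}"
    and e: "e \<in> cg_edges (side V a b \<union> X)" and f: "f \<in> cg_edges (side V b a \<union> Y)"
  shows "\<not> edges_cross e f"
proof (rule split_line_not_cross[OF _ _ _ e f, of b a])
  show "orient b a x \<le> 0" if "x \<in> side V a b \<union> X" for x
    using that XY orient_flip[of a b x] unfolding side_def by auto
  show "orient b a x \<ge> 0" if "x \<in> side V b a \<union> Y" for x
    using that XY unfolding side_def by auto
  show "x \<in> {b, a}" if "x \<in> side V a b \<union> X \<union> (side V b a \<union> Y)" "orient b a x = 0" for x
    using that XY orient_flip[of a b x] unfolding side_def by auto
qed

text \<open>\<open>X\<close> and \<open>Y\<close> say which of \<open>a\<close>, \<open>b\<close> go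
  to which half. A vertex in both is the hub at which spanning graphs of the complement would be
  joined.\<close>

lemma split_blocking:
  assumes gp: "general_position V" and ab: "a \<in> V" "b \<in> V" "a \<noteq> b"
    and bl: "\<not> contains_simple_spanning (- B) V"
    and XY: "X \<union> Y = {a, b}" "X \<inter> Y \<noteq> {}"
  shows "connected_on (side V a b \<union> X) B \<or> connected_on (side V b a \<union> Y) B"
proof -
  let ?L = "side V a b \<union> X" and ?R = "side V b a \<union> Y"
  have LR: "?L \<union> ?R = V" using side_cases[OF gp ab] XY by blast
  obtain c where "c \<in> ?L" "c \<in> ?R" using XY by blast
  then have "\<not> contains_simple_spanning (- B) ?L \<or> \<not> contains_simple_spanning (- B) ?R"
    using contains_simple_spanning_join[of "- B" ?L ?R c] side_not_cross[OF gp ab, of X Y] LR XY bl by auto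
  moreover have "?L \<noteq> {}" "?R \<noteq> {}" "?L \<subseteq> V" "?R \<subseteq> V" using XY LR by blast+
  ultimately show ?thesis using connected_on_of_blocking[OF gp] by blast
qed

text \<open>Here the halves may be disjoint: a missing hull edge from one side to the other belongs
  to the complement and bridges them.\<close>

lemma split_blocking_hull_edge:
  assumes gp: "general_position V" and ab: "a \<in> V" "b \<in> V" "a \<noteq> b"
    and bl: "\<not> contains_simple_spanning (- B) V"
    and uv: "u \<in> side V a b" "v \<in> side V b a" "hull_edge V u v \<or> hull_edge V v u" "{u, v} \<notin> B"
    and XY: "X \<union> Y = {a, b}"
  shows "connected_on (side V a b \<union> X) B \<or> connected_on (side V b a \<union> Y) B"
proof -
  let ?L = "side V a b \<union> X" and ?R = "side V b a \<union> Y"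
  have LR: "?L \<union> ?R = V" using side_cases[OF gp ab] XY by blast
  then have "\<not> contains_simple_spanning (- B) ?L \<or> \<not> contains_simple_spanning (- B) ?R"
    using contains_simple_spanning_bridge[of "- B" ?L ?R u v] side_not_cross[OF gp ab, of X Y] uv XY bl by auto
  moreover have "?L \<noteq> {}" "?R \<noteq> {}" "?L \<subseteq> V" "?R \<subseteq> V" using uv LR by blast+
  ultimately show ?thesis using connected_on_of_blocking[OF gp] by blast
qed

text \<open>A vertex of \<open>S\<close> would reach \<open>a\<close> without meeting
  \<open>b\<close>, and \<open>b\<close> without meeting \<open>a\<close>, closing a cycle through
  ab.\<close>

lemma not_connected_to_both_ends:
  assumes gp: "general_position V" and t: "tight_blocker V B" and ab: "{a, b} \<in> B"
    and S: "x \<in> S" "a \<notin> S" "b \<notin> S" "connected_on (S \<union> {a}) B" "connected_on (S \<union> {b}) B"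
  shows False
proof -
  have ne: "a \<noteq> b" using ab t doubleton_in_cg_edges unfolding tight_blocker_def by blast
  have "linked (B - {{a, b}}) x a"
    by (rule connected_on_linked[OF S(4)]) (use S ne in \<open>auto simp: doubleton_in_cg_edges\<close>)
  moreover have "linked (B - {{a, b}}) x b"
    by (rule connected_on_linked[OF S(5)]) (use S ne in \<open>auto simp: doubleton_in_cg_edges\<close>)
  ultimately show False
    using tight_blocker_acyclic[OF gp t ab] linked_trans[OF linked_sym] by blast
qed

text \<open>Without the edge xy at most one of \<open>x\<close>, \<open>y\<close> is still linked to
  \<open>a\<close>. If \<open>x\<close> is cut off, the left half with \<open>a\<close> and
  \<open>b\<close> is not connected, so the splits make the right half connected both with
  \<open>a\<close> alone and with \<open>b\<close> alone, contrary to
  \<open>not_connected_to_both_ends\<close>. The case of \<open>y\<close> is symmetric.\<close>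

lemma tight_blocker_line:
  assumes gp: "general_position V" and t: "tight_blocker V B" and ab: "{a, b} \<in> B" and xy: "{x, y} \<in> B"
  shows "\<not> (orient a b x > 0 \<and> orient a b y < 0)"
proof
  assume o: "orient a b x > 0 \<and> orient a b y < 0"
  have sub: "B \<subseteq> cg_edges V" and bl: "\<not> contains_simple_spanning (- B) V"
    using t unfolding tight_blocker_def by auto
  have V: "a \<in> V" "b \<in> V" "a \<noteq> b" "x \<in> V" "y \<in> V" "x \<noteq> y"
    using ab xy sub doubleton_in_cg_edges by blast+
  let ?L = "side V a b" and ?R = "side V b a"
  have x: "x \<in> ?L" "x \<notin> ?R" and y: "y \<in> ?R" "y \<notin> ?L"
    using o V orient_flip[of a b] unfolding side_def by auto
  have ne: "{a, b} \<noteq> {x, y}" using o by (auto simp: doubleton_eq_iff)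
  have ab': "linked (B - {{x, y}}) a b" "linked (B - {{x, y}}) b a"
    using ab ne linked_edge[of a b "B - {{x, y}}"] linked_sym by blast+
  \<comment> \<open>The half contains \<open>x\<close> but not \<open>y\<close>, so walks inside it
    avoid xy; the surviving edge ab makes \<open>a\<close> and \<open>b\<close> interchangeable as
    targets.\<close>
  have L: "linked (B - {{x, y}}) x a" if "c \<in> {a, b}" "c \<in> X" "X \<subseteq> {a, b}" "connected_on (?L \<union> X) B" for c X
  proof -
    have "y \<notin> ?L \<union> X" using y that(3) o by auto
    then have "linked (B - {{x, y}}) x c"
      by (intro connected_on_linked[OF that(4)]) (use x that in \<open>auto simp: doubleton_in_cg_edges\<close>)
    then show ?thesis using that(1) ab' linked_trans by blast
  qed
  have R: "linked (B - {{x, y}}) y a" if "c \<in> {a, b}" "c \<in> X" "X \<subseteq> {a, b}" "connected_on (?R \<union> X) B" for c X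
  proof -
    have "x \<notin> ?R \<union> X" using x that(3) o by auto
    then have "linked (B - {{x, y}}) y c"
      by (intro connected_on_linked[OF that(4)]) (use y that in \<open>auto simp: doubleton_in_cg_edges\<close>)
    then show ?thesis using that(1) ab' linked_trans by blast
  qed
  note split = split_blocking[OF gp V(1-3) bl]
  have s: "connected_on (?L \<union> {a}) B \<or> connected_on (?R \<union> {a, b}) B"
    "connected_on (?L \<union> {b}) B \<or> connected_on (?R \<union> {a, b}) B"
    "connected_on (?L \<union> {a, b}) B \<or> connected_on (?R \<union> {a}) B"
    "connected_on (?L \<union> {a, b}) B \<or> connected_on (?R \<union> {b}) B"
    by (rule split; blast)+
  have "\<not> (linked (B - {{x, y}}) x a \<and> linked (B - {{x, y}}) y a)"
    using tight_blocker_acyclic[OF gp t xy] linked_trans[OF _ linked_sym] by blast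
  then consider "\<not> linked (B - {{x, y}}) x a" | "\<not> linked (B - {{x, y}}) y a" by blast
  then show False
  proof cases
    case 1
    then have "connected_on (?R \<union> {a}) B" "connected_on (?R \<union> {b}) B"
      using s(3,4) L[of a "{a, b}"] by auto
    then show False using not_connected_to_both_ends[OF gp t ab y(1)] side_disjoint by blast
  next
    case 2
    then have "connected_on (?L \<union> {a}) B" "connected_on (?L \<union> {b}) B"
      using s(1,2) R[of a "{a, b}"] by auto
    then show False using not_connected_to_both_ends[OF gp t ab x(1)] side_disjoint by blast
  qed
qed

lemma leaf_unique:
  assumes "leaf B v" "{v, x} \<in> B" "{v, y} \<in> B"
  shows "x = y"
proof -
  have "{v, x} = {v, y}" using assms unfolding leaf_def by blast
  then show ?thesis by (auto simp: doubleton_eq_iff)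
qed

text \<open>A further neighbour \<open>x\<close> of \<open>b\<close> lies on one of the two sides
  and reaches \<open>a\<close> there without touching \<open>b\<close>; together with ab and bx this
  is a cycle.\<close>

lemma not_leaf_connected_sides:
  assumes gp: "general_position V" and t: "tight_blocker V B" and ab: "{a, b} \<in> B"
    and nl: "\<not> leaf B b"
    and con: "connected_on (side V a b \<union> {a}) B" "connected_on (side V b a \<union> {a}) B"
  shows False
proof -
  have sub: "B \<subseteq> cg_edges V" using t unfolding tight_blocker_def by blast
  have V: "a \<in> V" "b \<in> V" "a \<noteq> b" using ab sub doubleton_in_cg_edges by blast+
  obtain e where e: "e \<in> B" "b \<in> e" "e \<noteq> {a, b}" using nl ab unfolding leaf_def by blast
  then obtain x where x: "e = {b, x}" "x \<in> V" "x \<noteq> b"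
    using sub unfolding cg_edges_def by (auto simp: insert_commute)
  then have xa: "x \<noteq> a" using e by (auto simp: insert_commute)
  have bn: "b \<notin> side V a b \<union> {a}" "b \<notin> side V b a \<union> {a}" using side_disjoint V by auto
  have "x \<in> side V a b \<union> {a} \<or> x \<in> side V b a \<union> {a}" using side_cases[OF gp V] x xa by blast
  moreover have "B \<inter> cg_edges (side V a b \<union> {a}) \<subseteq> B - {{b, x}}"
    "B \<inter> cg_edges (side V b a \<union> {a}) \<subseteq> B - {{b, x}}"
    using bn by (auto simp: doubleton_in_cg_edges)
  ultimately have "linked (B - {{b, x}}) x a"
    using connected_on_linked[OF con(1), of x a "B - {{b, x}}"]
      connected_on_linked[OF con(2), of x a "B - {{b, x}}"] by blast
  moreover have "{a, b} \<in> B - {{b, x}}" using ab xa by (auto simp: doubleton_eq_iff)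
  ultimately have "linked (B - {{b, x}}) x b" by (rule linked_trans[OF _ linked_edge])
  then show False using tight_blocker_acyclic[OF gp t, of b x] e(1) x(1) linked_sym[of _ x b] by blast
qed

text \<open>The hull edge as bridge permits disjoint halves, so \<open>a\<close> goes left and
  \<open>b\<close> right, or conversely. This gives two alternatives, and each of the four ways to
  choose one statement from each closes a cycle in \<open>B\<close>.\<close>

lemma missing_hull_edge_same_side:
  assumes gp: "general_position V" and t: "tight_blocker V B" and ab: "{a, b} \<in> B"
    and nl: "\<not> leaf B a" "\<not> leaf B b"
    and uv: "hull_edge V u v \<or> hull_edge V v u" "{u, v} \<notin> B" "u \<in> side V a b" "v \<in> side V b a"
  shows False
proof -
  have sub: "B \<subseteq> cg_edges V" and bl: "\<not> contains_simple_spanning (- B) V"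
    using t unfolding tight_blocker_def by auto
  have V: "a \<in> V" "b \<in> V" "a \<noteq> b" using ab sub doubleton_in_cg_edges by blast+
  have ba: "{b, a} \<in> B" using ab by (simp add: insert_commute)
  let ?L = "side V a b" and ?R = "side V b a"
  note split = split_blocking_hull_edge[OF gp V bl uv(3,4,1,2)]
  have 1: "connected_on (?L \<union> {a}) B \<or> connected_on (?R \<union> {b}) B" by (rule split) blast
  have 2: "connected_on (?L \<union> {b}) B \<or> connected_on (?R \<union> {a}) B" by (rule split) blast
  have 3: "\<not> (connected_on (?L \<union> {a}) B \<and> connected_on (?L \<union> {b}) B)"
    using not_connected_to_both_ends[OF gp t ab uv(3)] side_disjoint by blast
  have 4: "\<not> (connected_on (?R \<union> {a}) B \<and> connected_on (?R \<union> {b}) B)"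
    using not_connected_to_both_ends[OF gp t ab uv(4)] side_disjoint by blast
  have 5: "\<not> (connected_on (?L \<union> {a}) B \<and> connected_on (?R \<union> {a}) B)"
    using not_leaf_connected_sides[OF gp t ab nl(2)] by blast
  have 6: "\<not> (connected_on (?R \<union> {b}) B \<and> connected_on (?L \<union> {b}) B)"
    using not_leaf_connected_sides[OF gp t ba nl(1)] by blast
  from 1 2 3 4 5 6 show False by blast
qed

section \<open>Edges between non-leaves\<close>

text \<open>After the deletion only \<open>b\<close> remains adjacent to \<open>a\<close>, so the
  second neighbour that \<open>a\<close> had must be \<open>w\<close>.\<close>

lemma leaf_after_delete:
  assumes sub: "B \<subseteq> cg_edges V" and ab: "{a, b} \<in> B" and ne: "w \<noteq> a" "w \<noteq> b"
    and nl: "\<not> leaf B a" and l: "leaf (B \<inter> cg_edges (V - {w})) a"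
  shows "{a, w} \<in> B" "\<And>x. {a, x} \<in> B \<Longrightarrow> x \<in> {b, w}"
proof -
  let ?B = "B \<inter> cg_edges (V - {w})"
  have del: "{a, x} \<in> ?B" if "{a, x} \<in> B" "x \<noteq> w" for x
    using that subsetD[OF sub that(1)] ne by (simp add: doubleton_in_cg_edges)
  have abB: "{a, b} \<in> ?B" using del ab ne by blast
  show *: "x \<in> {b, w}" if "{a, x} \<in> B" for x
  proof (cases "x = w")
    case False
    then show ?thesis using leaf_unique[OF l abB] del[OF that] by blast
  qed simp
  obtain e where e: "e \<in> B" "a \<in> e" "e \<noteq> {a, b}" using nl ab unfolding leaf_def by blast
  then obtain x where x: "e = {a, x}" using sub unfolding cg_edges_def by (auto simp: insert_commute)
  then show "{a, w} \<in> B" using *[of x] e by auto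
qed

text \<open>Otherwise both sides of ab contain vertices. A missing hull edge uv has leaves as its
  ends, and both lie on one side of ab. Deleting either end leaves both sides occupied, so by
  induction \<open>a\<close> or \<open>b\<close> becomes a leaf. It is not the same vertex for both
  deletions, hence \<open>B\<close> is a path on \<open>u\<close>, \<open>v\<close>,
  \<open>a\<close>, \<open>b\<close> with middle edge ab, and one side of ab is empty after
  all.\<close>

lemma nonleaf_edge_is_hull_edge:
  assumes "general_position V" "tight_blocker V B" "{a, b} \<in> B" "\<not> leaf B a" "\<not> leaf B b"
  shows "hull_edge V a b \<or> hull_edge V b a"
  using assms
proof (induction "card V" arbitrary: V B rule: less_induct)
  case less
  note gp = less.prems(1) and t = less.prems(2) and ab = less.prems(3) and nl = less.prems(4,5)
  have fin: "finite V" by (rule general_position_finite[OF gp])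
  have sub: "B \<subseteq> cg_edges V" and bl: "\<not> contains_simple_spanning (- B) V"
    using t unfolding tight_blocker_def by auto
  have V: "a \<in> V" "b \<in> V" "a \<noteq> b" using ab sub doubleton_in_cg_edges by blast+
  note cases = side_cases[OF gp V]
  show ?case
  proof (rule ccontr)
    assume nh: "\<not> ?case"
    have "side V a b \<noteq> {}"
    proof
      assume "side V a b = {}"
      then have "x \<in> side V b a" if "x \<in> V - {a, b}" for x using cases that by blast
      then have "hull_edge V b a" using V unfolding hull_edge_def side_def by blast
      then show False using nh by blast
    qed
    moreover have "side V b a \<noteq> {}"
    proof
      assume "side V b a = {}"
      then have "x \<in> side V a b" if "x \<in> V - {a, b}" for x using cases that by blast
      then have "hull_edge V a b" using V unfolding hull_edge_def side_def by blast
      then show False using nh by blast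
    qed
    ultimately obtain l r where lr: "l \<in> side V a b" "r \<in> side V b a" by blast
    have "l \<noteq> a" "l \<noteq> b" using lr side_disjoint by blast+
    then have "card {a, b, l} = 3" using V by simp
    moreover have "{a, b, l} \<subseteq> V" using V lr side_disjoint by blast
    ultimately have "card V \<ge> 3" using card_mono[OF fin] by metis
    then obtain u v where h: "hull_edge V u v" and uv: "{u, v} \<notin> B"
      using ex_hull_edge_not_in_blocker[OF gp t] by blast
    have vu: "{v, u} \<notin> B" using uv by (simp add: insert_commute)
    have uvV: "u \<in> V" "v \<in> V" "u \<noteq> v" using h unfolding hull_edge_def by auto
    note delu = tight_blocker_delete[OF gp t disjI1[OF h] uv]
    note delv = tight_blocker_delete[OF gp t disjI2[OF h] vu]
    have ne: "u \<noteq> a" "u \<noteq> b" "v \<noteq> a" "v \<noteq> b" using delu(1) delv(1) nl by auto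
    have ba: "{b, a} \<in> B" using ab by (simp add: insert_commute)
    have same: "(u \<in> side V a b \<and> v \<in> side V a b) \<or> (u \<in> side V b a \<and> v \<in> side V b a)"
    proof (rule ccontr)
      assume "\<not> ?thesis"
      then have "(u \<in> side V a b \<and> v \<in> side V b a) \<or> (v \<in> side V a b \<and> u \<in> side V b a)"
        using cases uvV ne by blast
      then show False
        using missing_hull_edge_same_side[OF gp t ab nl, of u v] missing_hull_edge_same_side[OF gp t ab nl, of v u]
          h uv vu by blast
    qed
    have del: "leaf (B \<inter> cg_edges (V - {w})) a \<or> leaf (B \<inter> cg_edges (V - {w})) b"
      if w: "w \<in> {u, v}" for w
    proof (rule ccontr)
      assume no: "\<not> ?thesis"
      let ?W = "V - {w}" and ?B = "B \<inter> cg_edges (V - {w})"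
      have wV: "w \<in> V" "w \<noteq> a" "w \<noteq> b" using w uvV ne by auto
      have "tight_blocker ?W ?B" using delu delv w by blast
      moreover have "card ?W < card V" using card_Diff1_less[OF fin wV(1)] .
      moreover have "general_position ?W" using general_position_subset[OF gp] by blast
      moreover have "{a, b} \<in> ?B" using ab V wV by (auto simp: doubleton_in_cg_edges)
      ultimately have hW: "hull_edge ?W a b \<or> hull_edge ?W b a" using less.hyps[of ?W ?B] no by blast
      \<comment> \<open>The side of \<open>w\<close> keeps the other end of the missing hull edge,
        and the opposite side is untouched.\<close>
      obtain x y where x: "x \<in> side V a b" "x \<noteq> w" and y: "y \<in> side V b a" "y \<noteq> w"
      proof -
        have sd: "side V a b \<inter> side V b a = {}" using orient_flip[of a b] unfolding side_def by force
        show ?thesis using that same w lr sd uvV(3) by blast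
      qed
      then have "orient a b x > 0" "orient a b y < 0" "x \<in> ?W - {a, b}" "y \<in> ?W - {a, b}"
        using orient_flip[of a b] unfolding side_def by auto
      then have "orient b a x < 0" "orient a b y < 0" "x \<in> ?W - {b, a}" "y \<in> ?W - {a, b}"
        using orient_flip[of a b] by auto
      then have "\<not> hull_edge ?W a b" "\<not> hull_edge ?W b a"
        unfolding hull_edge_def by (meson less_asym)+
      then show False using hW by blast
    qed
    have A: "{a, w} \<in> B \<and> (\<forall>x. {a, x} \<in> B \<longrightarrow> x \<in> {b, w})"
      if "leaf (B \<inter> cg_edges (V - {w})) a" "w \<in> {u, v}" for w
      using leaf_after_delete[OF sub ab _ _ nl(1) that(1)] that(2) ne by blast
    have Bb: "{b, w} \<in> B \<and> (\<forall>x. {b, x} \<in> B \<longrightarrow> x \<in> {a, w})"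
      if "leaf (B \<inter> cg_edges (V - {w})) b" "w \<in> {u, v}" for w
      using leaf_after_delete[OF sub ba _ _ nl(2) that(1)] that(2) ne by blast
    obtain p q where pq: "{p, q} = {u, v}" "leaf (B \<inter> cg_edges (V - {p})) a"
      "leaf (B \<inter> cg_edges (V - {q})) b"
    proof -
      have "\<not> (leaf (B \<inter> cg_edges (V - {u})) a \<and> leaf (B \<inter> cg_edges (V - {v})) a)"
        using A[of u] A[of v] uvV(3) ne by blast
      moreover have "\<not> (leaf (B \<inter> cg_edges (V - {u})) b \<and> leaf (B \<inter> cg_edges (V - {v})) b)"
        using Bb[of u] Bb[of v] uvV(3) ne by blast
      ultimately consider "leaf (B \<inter> cg_edges (V - {u})) a" "leaf (B \<inter> cg_edges (V - {v})) b"
        | "leaf (B \<inter> cg_edges (V - {v})) a" "leaf (B \<inter> cg_edges (V - {u})) b"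
        using del[of u] del[of v] by blast
      then show ?thesis using that[of u v] that[of v u] by cases blast+
    qed
    have pm: "p \<in> {u, v}" "q \<in> {u, v}" using pq(1) by blast+
    have leafs: "leaf B p" "leaf B q" using pm delu(1) delv(1) by auto
    have ap: "{a, p} \<in> B" "\<And>x. {a, x} \<in> B \<Longrightarrow> x \<in> {b, p}" using A[OF pq(2) pm(1)] by blast+
    have bq: "{b, q} \<in> B" "\<And>x. {b, x} \<in> B \<Longrightarrow> x \<in> {a, q}" using Bb[OF pq(3) pm(2)] by blast+
    have P: "x = a" if "{p, x} \<in> B" for x
      using leaf_unique[OF leafs(1) that] ap(1) by (simp add: insert_commute)
    have Q: "x = b" if "{q, x} \<in> B" for x
      using leaf_unique[OF leafs(2) that] bq(1) by (simp add: insert_commute)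
    have "linked B a r" using connected_on_linked[OF tight_blocker_tree(1)[OF gp t] V(1), of r B]
        lr side_disjoint by blast
    \<comment> \<open>The four vertices are closed under adjacency in \<open>B\<close>, so they are
      all that \<open>a\<close> can reach.\<close>
    then have rin: "r \<in> {a, b, p, q}"
    proof (induction rule: linked_induct)
      case (step x y)
      then show ?case using ap(2) bq(2) P Q by blast
    qed simp
    have "linked B a l" using connected_on_linked[OF tight_blocker_tree(1)[OF gp t] V(1), of l B]
        lr side_disjoint by blast
    then have lin: "l \<in> {a, b, p, q}"
    proof (induction rule: linked_induct)
      case (step x y)
      then show ?case using ap(2) bq(2) P Q by blast
    qed simp
    have sd: "side V a b \<inter> side V b a = {}" using orient_flip[of a b] unfolding side_def by force
    have "r \<in> {u, v}" "l \<in> {u, v}" using rin lin pm lr side_disjoint by blast+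
    then show False using same lr sd by blast
  qed
qed

section \<open>Hull edges and the spine\<close>

text \<open>The three signed areas divided by \<open>orient a b c\<close> are the barycentric
  coordinates of \<open>z\<close>.\<close>

lemma in_triangle:
  assumes "orient a b c > 0" "orient a b z \<ge> 0" "orient b c z \<ge> 0" "orient c a z \<ge> 0"
  shows "z \<in> convex hull {a, b, c}"
proof -
  let ?d = "orient a b c"
  have s: "orient b c z + orient c a z + orient a b z = ?d" unfolding orient_def by algebra
  have "?d * z$i = orient b c z * a$i + orient c a z * b$i + orient a b z * c$i" for i
    using exhaust_2[of i] by (auto simp: orient_def algebra_simps)
  then have "z$i = (orient b c z / ?d) * a$i + (orient c a z / ?d) * b$i + (orient a b z / ?d) * c$i" for i
    using assms(1) by (simp add: field_simps)
  then have "z = (orient b c z / ?d) *\<^sub>R a + (orient c a z / ?d) *\<^sub>R b + (orient a b z / ?d) *\<^sub>R c"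
    by (simp add: vec_eq_iff)
  moreover have "orient b c z / ?d + orient c a z / ?d + orient a b z / ?d = 1"
    using s assms(1) by (simp add: add_divide_distrib[symmetric])
  ultimately show ?thesis using assms unfolding convex_hull_3
    by (intro CollectI exI conjI) auto
qed

text \<open>The four open half-planes bounded by the lines bx, xa, ay and yb have the midpoint in
  common, and each point of their intersection lies in the triangle on its own side of ab.\<close>

lemma midpoint_interior:
  assumes "orient a b x > 0" "orient a b y < 0"
  shows "midpoint a b \<in> interior (convex hull {a, b, x, y})"
proof (rule interiorI)
  let ?O = "{z. 0 < orient b x z} \<inter> {z. 0 < orient x a z} \<inter> {z. 0 < orient a y z} \<inter> {z. 0 < orient y b z}"
  show "open ?O" unfolding orient_def
    by (intro open_Int open_Collect_less continuous_intros)
  have m: "midpoint a b = (1 - 1/2) *\<^sub>R a + (1/2) *\<^sub>R b"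
    by (simp add: midpoint_def algebra_simps)
  have mm: "orient p q (midpoint a b) = (orient p q a + orient p q b) / 2" for p q
    unfolding m orient_affine by simp
  show "midpoint a b \<in> ?O"
    using assms orient_rotate[of a b x] orient_rotate[of x a b] orient_rotate[of a y b]
      orient_rotate[of y b a] orient_swap[of a b y]
    by (simp add: mm)
  show "?O \<subseteq> convex hull {a, b, x, y}"
  proof
    fix z assume z: "z \<in> ?O"
    show "z \<in> convex hull {a, b, x, y}"
    proof (cases "orient a b z \<ge> 0")
      case True
      then have "z \<in> convex hull {a, b, x}" using in_triangle[of a b x z] assms z by simp
      then show ?thesis using hull_mono[of "{a, b, x}" "{a, b, x, y}" convex] by auto
    next
      case False
      then have "z \<in> convex hull {b, a, y}"
        using in_triangle[of b a y z] assms z orient_flip[of a b] by simp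
      then show ?thesis using hull_mono[of "{b, a, y}" "{a, b, x, y}" convex] by auto
    qed
  qed
qed

lemma hull_edge_frontier:
  assumes h: "hull_edge V a b"
  shows "convex hull {a, b} \<subseteq> frontier (convex hull V)"
proof
  fix z assume z: "z \<in> convex hull {a, b}"
  have V: "a \<in> V" "b \<in> V" "a \<noteq> b" using h unfolding hull_edge_def by auto
  have conv: "convex {x. orient a b x \<ge> 0}"
    unfolding convex_alt by (auto simp: orient_affine)
  have "V \<subseteq> {x. orient a b x \<ge> 0}"
  proof
    fix x assume "x \<in> V"
    then show "x \<in> {x. orient a b x \<ge> 0}"
      using h unfolding hull_edge_def by (cases "x \<in> {a, b}") (auto intro: less_imp_le)
  qed
  then have hull: "convex hull V \<subseteq> {x. orient a b x \<ge> 0}" by (rule hull_minimal) (rule conv)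
  obtain u where u: "z = (1 - u) *\<^sub>R a + u *\<^sub>R b" using z unfolding convex_hull_doubleton by blast
  have z0: "orient a b z = 0" unfolding u orient_affine by simp
  have "z \<notin> interior (convex hull V)"
  proof
    assume "z \<in> interior (convex hull V)"
    then obtain e where e: "e > 0" "ball z e \<subseteq> convex hull V" unfolding mem_interior by blast
    \<comment> \<open>The inner normal of ab: a small step from \<open>z\<close> against it leaves
      the half-plane containing the hull.\<close>
    define n :: point where "n = vector [- (b$2 - a$2), b$1 - a$1]"
    have nn: "n$1 = - (b$2 - a$2)" "n$2 = b$1 - a$1" by (simp_all add: n_def)
    have n0: "n \<noteq> 0" using V(3) nn by (auto simp: vec_eq_iff forall_2)
    define d where "d = e / (2 * norm n)"
    have d: "d > 0" using e n0 by (simp add: d_def)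
    have "dist z (z - d *\<^sub>R n) < e" using e n0 by (simp add: dist_norm d_def)
    then have "z - d *\<^sub>R n \<in> ball z e" unfolding mem_ball .
    then have "orient a b (z - d *\<^sub>R n) \<ge> 0" using e(2) hull by blast
    moreover have "orient a b (z - d *\<^sub>R n) = orient a b z - d * ((n$1)\<^sup>2 + (n$2)\<^sup>2)"
      unfolding orient_def nn vector_minus_component vector_scaleR_component
      by (simp add: nn power2_eq_square algebra_simps)
    moreover have "(n$1)\<^sup>2 + (n$2)\<^sup>2 > 0"
      using n0 by (auto simp: vec_eq_iff forall_2 sum_power2_gt_zero_iff)
    ultimately show False using z0 d by (simp add: mult_le_0_iff)
  qed
  moreover have "z \<in> closure (convex hull V)"
    using z hull_mono[of "{a, b}" V convex] V closure_subset by blast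
  ultimately show "z \<in> frontier (convex hull V)" unfolding frontier_def by blast
qed

text \<open>With vertices strictly on both sides of ab, the midpoint of ab would be interior to the
  hull.\<close>

lemma boundary_edge_iff:
  assumes gp: "general_position V" and ab: "a \<in> V" "b \<in> V" "a \<noteq> b"
  shows "boundary_edge V {a, b} \<longleftrightarrow> hull_edge V a b \<or> hull_edge V b a"
proof
  assume "boundary_edge V {a, b}"
  then have fr: "convex hull {a, b} \<subseteq> frontier (convex hull V)" unfolding boundary_edge_def by blast
  show "hull_edge V a b \<or> hull_edge V b a"
  proof (rule ccontr)
    assume no: "\<not> ?thesis"
    note cases = side_cases[OF gp ab]
    have "side V a b \<noteq> {}"
    proof
      assume "side V a b = {}"
      then have "x \<in> side V b a" if "x \<in> V - {b, a}" for x using cases that by blast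
      then show False using ab no unfolding hull_edge_def side_def by blast
    qed
    moreover have "side V b a \<noteq> {}"
    proof
      assume "side V b a = {}"
      then have "x \<in> side V a b" if "x \<in> V - {a, b}" for x using cases that by blast
      then show False using ab no unfolding hull_edge_def side_def by blast
    qed
    ultimately obtain x y where xy: "x \<in> V" "y \<in> V" "orient a b x > 0" "orient a b y < 0"
      using orient_flip[of a b] unfolding side_def by auto
    have "midpoint a b \<in> interior (convex hull V)"
      using midpoint_interior[OF xy(3,4)] interior_mono[OF hull_mono[of "{a, b, x, y}" V convex]] ab xy
      by blast
    moreover have "midpoint a b \<in> convex hull {a, b}"
      by (simp add: segment_convex_hull[symmetric])
    ultimately show False using fr unfolding frontier_def by blast
  qed
next
  assume "hull_edge V a b \<or> hull_edge V b a"
  then show "boundary_edge V {a, b}"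
    using hull_edge_frontier[of V a b] hull_edge_frontier[of V b a] cg_edgesI[OF ab]
    unfolding boundary_edge_def by (auto simp: insert_commute)
qed

lemma hull_edge_successor_unique:
  assumes "hull_edge V a b" "hull_edge V a c"
  shows "b = c"
proof (rule ccontr)
  assume "b \<noteq> c"
  then have "orient a b c > 0" "orient a c b > 0" using assms unfolding hull_edge_def by auto
  then show False using orient_swap[of a b c] by simp
qed

lemma hull_edge_predecessor_unique:
  assumes "hull_edge V b a" "hull_edge V c a"
  shows "b = c"
proof (rule ccontr)
  assume "b \<noteq> c"
  then have "orient b a c > 0" "orient c a b > 0" using assms unfolding hull_edge_def by auto
  then show False using orient_rotate[of c a b] orient_swap[of b a c] orient_rotate[of a b c]
    orient_flip[of b a c] by simp
qed

lemma card_star: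
  assumes "finite V" "c \<in> V"
  shows "card (star V c) + 1 = card V"
proof -
  have "star V c = (\<lambda>x. {c, x}) ` (V - {c})"
    using assms(2) unfolding star_def cg_edges_def by (auto simp: insert_commute)
  moreover have "inj_on (\<lambda>x. {c, x}) (V - {c})" by (rule inj_onI) (auto simp: doubleton_eq_iff)
  ultimately have "card (star V c) = card (V - {c})" by (simp add: card_image)
  then show ?thesis using card_Suc_Diff1[OF assms] by simp
qed

lemma set_butlast_tl: "set (butlast (tl ps)) = {ps ! i | i. 0 < i \<and> Suc i < length ps}"
proof -
  have "set (butlast (tl ps)) = {butlast (tl ps) ! i | i. i < length ps - 2}"
    by (auto simp: set_conv_nth)
  also have "\<dots> = {ps ! Suc i | i. i < length ps - 2}"
    by (intro Collect_cong ex_cong1) (auto simp: nth_butlast nth_tl)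
  also have "\<dots> = {ps ! i | i. 0 < i \<and> Suc i < length ps}"
  proof (intro set_eqI iffI)
    fix x assume "x \<in> {ps ! i | i. 0 < i \<and> Suc i < length ps}"
    then obtain i where "x = ps ! i" "0 < i" "Suc i < length ps" by blast
    then show "x \<in> {ps ! Suc i | i. i < length ps - 2}"
      by (intro CollectI exI[of _ "i - 1"]) auto
  qed auto
  finally show ?thesis .
qed

section \<open>The spine as a maximal path along the hull\<close>

text \<open>If all neighbours of \<open>q\<close> were leaves, connectivity would make
  \<open>B\<close> the star at \<open>q\<close>. So \<open>q\<close> has a non-leaf neighbour, the
  edge to it is a hull edge, and \<open>q\<close> is a hull vertex. Both hull edges at
  \<open>q\<close> belong to \<open>B\<close>, as a missing one would make \<open>q\<close> a
  leaf.\<close>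

lemma tight_blocker_nonleaf:
  assumes gp: "general_position V" and t: "tight_blocker V B"
    and ns: "\<not> is_star V B" and q: "q \<in> V" "\<not> leaf B q"
  shows "\<exists>r. {q, r} \<in> B \<and> \<not> leaf B r"
    "\<exists>p s. hull_edge V p q \<and> {p, q} \<in> B \<and> hull_edge V q s \<and> {q, s} \<in> B"
proof -
  have fin: "finite V" by (rule general_position_finite[OF gp])
  have sub: "B \<subseteq> cg_edges V" and c: "card B + 1 = card V" using t unfolding tight_blocker_def by auto
  have con: "linked B u v" if "u \<in> V" "v \<in> V" for u v
    using connected_on_linked[OF tight_blocker_tree(1)[OF gp t] that] by blast
  show r: "\<exists>r. {q, r} \<in> B \<and> \<not> leaf B r"
  proof (rule ccontr)
    assume "\<not> ?thesis"
    then have l: "\<And>r. {q, r} \<in> B \<Longrightarrow> leaf B r" by blast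
    have nb: "v = q \<or> {q, v} \<in> B" if "v \<in> V" for v
      using con[OF q(1) that]
    proof (induction rule: linked_induct)
      case (step x y)
      show ?case
      proof (cases "x = q")
        case True
        then show ?thesis using step.hyps by simp
      next
        case False
        then have "{q, x} \<in> B" using step.IH by simp
        then have "y = q"
          using leaf_unique[OF l[of x], of y q] step.hyps by (simp add: insert_commute)
        then show ?thesis by simp
      qed
    qed simp
    have "star V q \<subseteq> B"
    proof
      fix e assume "e \<in> star V q"
      then have e: "e \<in> cg_edges V" "q \<in> e" unfolding star_def by auto
      obtain x y where "e = {x, y}" "x \<in> V" "y \<in> V" "x \<noteq> y" using e(1) by (rule cg_edgesE)
      then show "e \<in> B" using e(2) nb[of x] nb[of y] by (auto simp: insert_commute)
    qed
    moreover have "card B = card (star V q)" using card_star[OF fin q(1)] c by simp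
    moreover have "finite B" using finite_subset[OF sub finite_cg_edges[OF fin]] .
    ultimately have "star V q = B" by (intro card_subset_eq) auto
    then show False using ns q(1) unfolding is_star_def by blast
  qed
  then obtain r where r: "{q, r} \<in> B" "\<not> leaf B r" by blast
  then have h: "hull_edge V q r \<or> hull_edge V r q"
    using nonleaf_edge_is_hull_edge[OF gp t] q by blast
  obtain p s where ps: "hull_edge V p q" "hull_edge V q s"
    using h hull_edge_successor[OF gp, of r q] hull_edge_predecessor[OF gp, of q r] by blast
  have "{q, s} \<in> B" using tight_blocker_delete(1)[OF gp t disjI1[OF ps(2)]] q by blast
  moreover have "{q, p} \<in> B" using tight_blocker_delete(1)[OF gp t disjI2[OF ps(1)]] q by blast
  ultimately show "\<exists>p s. hull_edge V p q \<and> {p, q} \<in> B \<and> hull_edge V q s \<and> {q, s} \<in> B"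
    using ps by (metis insert_commute)
qed

definition hull_path :: "point set \<Rightarrow> edge set \<Rightarrow> point list \<Rightarrow> bool" where
  "hull_path V B ps \<longleftrightarrow> distinct ps \<and> length ps \<ge> 2 \<and>
     (\<forall>i. Suc i < length ps \<longrightarrow> hull_edge V (ps ! i) (ps ! Suc i) \<and> {ps ! i, ps ! Suc i} \<in> B)"

lemma hull_path_subset:
  assumes "hull_path V B ps"
  shows "set ps \<subseteq> V"
proof
  fix x assume "x \<in> set ps"
  then obtain i where i: "i < length ps" "x = ps ! i" by (auto simp: in_set_conv_nth)
  show "x \<in> V"
  proof (cases "Suc i < length ps")
    case True
    then show ?thesis using assms i unfolding hull_path_def hull_edge_def by blast
  next
    case False
    then obtain j where "i = Suc j" using assms i unfolding hull_path_def by (cases i) auto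
    then show ?thesis using assms i unfolding hull_path_def hull_edge_def by blast
  qed
qed

text \<open>A closing edge would complete a cycle in \<open>B\<close>. A path of one edge is
  separate: its closing edge would be the same edge reversed, a hull edge both ways.\<close>

lemma hull_path_not_closed:
  assumes gp: "general_position V" and t: "tight_blocker V B" and c3: "card V \<ge> 3"
    and ps: "hull_path V B ps" and k: "length ps = Suc k"
    and h: "hull_edge V (ps ! k) (ps ! 0)"
  shows "{ps ! k, ps ! 0} \<notin> B"
proof
  assume inB: "{ps ! k, ps ! 0} \<in> B"
  have k1: "k \<ge> 1" using ps k unfolding hull_path_def by auto
  have d: "distinct ps" using ps unfolding hull_path_def by blast
  have "k \<noteq> 1"
  proof
    assume "k = 1"
    then have h': "hull_edge V (ps ! 0) (ps ! 1)" "hull_edge V (ps ! 1) (ps ! 0)"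
      using ps k h unfolding hull_path_def by auto
    have "card {ps ! 0, ps ! 1} \<le> 2" by (simp add: card_insert_if)
    then have "V \<noteq> {ps ! 0, ps ! 1}" using c3 by auto
    then obtain x where "x \<in> V - {ps ! 0, ps ! 1}" using h' unfolding hull_edge_def by blast
    then have "orient (ps ! 0) (ps ! 1) x > 0" "orient (ps ! 1) (ps ! 0) x > 0"
      using h' unfolding hull_edge_def by auto
    then show False using orient_flip[of "ps ! 0" "ps ! 1" x] by simp
  qed
  then have k2: "k \<ge> 2" using k1 by simp
  have "linked (B - {{ps ! k, ps ! 0}}) (ps ! 0) (ps ! i)" if "i \<le> k" for i
    using that
  proof (induction i)
    case (Suc i)
    have "{ps ! i, ps ! Suc i} \<noteq> {ps ! k, ps ! 0}"
      using d k k2 Suc.prems by (auto simp: doubleton_eq_iff nth_eq_iff_index_eq)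
    then have "{ps ! i, ps ! Suc i} \<in> B - {{ps ! k, ps ! 0}}"
      using ps k Suc.prems unfolding hull_path_def by auto
    then show ?case using linked_trans[OF Suc.IH linked_edge] Suc.prems by simp
  qed simp
  from linked_sym[OF this[OF order_refl]] tight_blocker_acyclic[OF gp t inB] show False by simp
qed

lemma ex_maximal_hull_path:
  assumes fin: "finite V" and ex: "hull_path V B qs"
  obtains ps where "hull_path V B ps" "\<And>qs. hull_path V B qs \<Longrightarrow> length qs \<le> length ps"
proof -
  have bound: "length qs \<le> card V" if "hull_path V B qs" for qs
    using that hull_path_subset[OF that] card_mono[OF fin] distinct_card[of qs]
    unfolding hull_path_def by metis
  obtain ps where "hull_path V B ps" "\<forall>qs. hull_path V B qs \<longrightarrow> length qs \<le> length ps"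
    using ex_has_greatest_nat[of "hull_path V B" qs length "Suc (card V)"] ex bound by (metis less_Suc_eq_le)
  then show ?thesis using that by blast
qed

lemma hull_path_snoc:
  assumes "hull_path V B ps" "length ps = Suc k" "hull_edge V (ps ! k) s" "{ps ! k, s} \<in> B" "s \<notin> set ps"
  shows "hull_path V B (ps @ [s])"
  using assms unfolding hull_path_def by (auto simp: nth_append less_Suc_eq)

lemma hull_path_Cons:
  assumes "hull_path V B ps" "hull_edge V p (ps ! 0)" "{p, ps ! 0} \<in> B" "p \<notin> set ps"
  shows "hull_path V B (p # ps)"
  using assms unfolding hull_path_def by (auto simp: nth_Cons split: nat.split)

text \<open>Both hull edges at a non-leaf end would be in \<open>B\<close>. The one leading away
  from the path extends it, or closes it to a cycle, or returns to another path vertex that already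
  has its hull neighbour in that direction.\<close>

lemma maximal_hull_path_end_leaf:
  assumes gp: "general_position V" and t: "tight_blocker V B" and c3: "card V \<ge> 3"
    and ns: "\<not> is_star V B" and ps: "hull_path V B ps" and k: "length ps = Suc k"
    and maxi: "\<And>qs. hull_path V B qs \<Longrightarrow> length qs \<le> length ps"
  shows "leaf B (ps ! 0)" "leaf B (ps ! k)"
proof -
  have d: "distinct ps" and step: "\<And>i. i < k \<Longrightarrow> hull_edge V (ps ! i) (ps ! Suc i)"
    using ps k unfolding hull_path_def by auto
  have in_V: "ps ! i \<in> V" if "i \<le> k" for i
    using hull_path_subset[OF ps] k that by (auto simp: subset_iff)
  show "leaf B (ps ! 0)"
  proof (rule ccontr)
    assume "\<not> ?thesis"
    then obtain p where p: "hull_edge V p (ps ! 0)" "{p, ps ! 0} \<in> B"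
      using tight_blocker_nonleaf(2)[OF gp t ns in_V[of 0]] by blast
    show False
    proof (cases "p \<in> set ps")
      case False
      then show False using maxi[OF hull_path_Cons[OF ps p]] by simp
    next
      case True
      then obtain j where j: "j \<le> k" "p = ps ! j" using k by (auto simp: in_set_conv_nth less_Suc_eq_le)
      show False
      proof (cases "j = k")
        case True
        then show False using hull_path_not_closed[OF gp t c3 ps k] p j by simp
      next
        case False
        then have "ps ! Suc j = ps ! 0" "Suc j < length ps"
          using hull_edge_successor_unique[OF step[of j]] p(1) j k by auto
        then show False using d k by (simp add: nth_eq_iff_index_eq)
      qed
    qed
  qed
  show "leaf B (ps ! k)"
  proof (rule ccontr)
    assume "\<not> ?thesis"
    then obtain s where s: "hull_edge V (ps ! k) s" "{ps ! k, s} \<in> B"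
      using tight_blocker_nonleaf(2)[OF gp t ns in_V[of k]] by blast
    show False
    proof (cases "s \<in> set ps")
      case False
      then show False using maxi[OF hull_path_snoc[OF ps k s]] by simp
    next
      case True
      then obtain j where j: "j \<le> k" "s = ps ! j" using k by (auto simp: in_set_conv_nth less_Suc_eq_le)
      show False
      proof (cases j)
        case 0
        then show False using hull_path_not_closed[OF gp t c3 ps k] s j by simp
      next
        case (Suc i)
        then have "ps ! i = ps ! k" "i < k"
          using hull_edge_predecessor_unique[OF step[of i]] s(1) j k by auto
        then show False using d k by (simp add: nth_eq_iff_index_eq)
      qed
    qed
  qed
qed

text \<open>A longest counterclockwise hull path in \<open>B\<close> is the spine. Its inner
  vertices turn out to be exactly the non-leaves: a non-leaf neighbour of one is a hull neighbour,
  hence on the path, and not one of the leaf ends. All other vertices are leaves attached to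
  them.\<close>

lemma nonstar_tight_blocker_is_comb:
  assumes gp: "general_position V" and t: "tight_blocker V B"
  and ns: "\<not> is_star V B"
  shows "comb V B"
proof -
  have fin: "finite V" by (rule general_position_finite[OF gp])
  have sub: "B \<subseteq> cg_edges V" and c: "card B + 1 = card V" using t unfolding tight_blocker_def by auto
  have con: "linked B u v" if "u \<in> V" "v \<in> V" for u v
    using connected_on_linked[OF tight_blocker_tree(1)[OF gp t] that] by blast
  have ends: "x \<in> V" "y \<in> V" "x \<noteq> y" if "{x, y} \<in> B" for x y
    using subsetD[OF sub that] doubleton_in_cg_edges by auto
  obtain v0 where v0: "v0 \<in> V" using tight_blocker_nonempty[OF t] by blast
  have star_eqI: False if "v \<in> V" "\<And>e. e \<in> B \<Longrightarrow> v \<in> e" for v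
  proof -
    have "B \<subseteq> star V v" using sub that(2) unfolding star_def by blast
    moreover have "card B = card (star V v)" using card_star[OF fin that(1)] c by simp
    moreover have "finite (star V v)"
      using finite_subset[OF _ finite_cg_edges[OF fin], of "star V v"] by (simp add: star_def)
    ultimately have "B = star V v" by (intro card_subset_eq) auto
    then show False using ns that(1) unfolding is_star_def by blast
  qed
  \<comment> \<open>An edge between two leaves would be a whole component, so V would consist of its
    ends and \<open>B\<close> would be a star.\<close>
  have nonleaf_end: "\<not> leaf B x \<or> \<not> leaf B y" if xy: "{x, y} \<in> B" for x y
  proof (rule ccontr)
    assume "\<not> ?thesis"
    then have l: "leaf B x" "leaf B y" by auto
    have yx: "{y, x} \<in> B" using xy by (simp add: insert_commute)
    have all: "v \<in> {x, y}" if "v \<in> V" for v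
      using con[OF ends(1)[OF xy] that]
    proof (induction rule: linked_induct)
      case (step p q)
      then show ?case using leaf_unique[OF l(1) xy, of q] leaf_unique[OF l(2) yx, of q] by auto
    qed simp
    show False
    proof (rule star_eqI[OF ends(1)[OF xy]])
      fix e assume "e \<in> B"
      then have "e \<in> cg_edges V" using sub by blast
      then obtain p q where "e = {p, q}" "p \<in> V" "q \<in> V" "p \<noteq> q" by (rule cg_edgesE)
      then show "x \<in> e" using all[of p] all[of q] by auto
    qed
  qed
  have "B \<noteq> {}" using star_eqI[OF v0] by blast
  then obtain e0 where e0: "e0 \<in> B" by blast
  then have "e0 \<in> cg_edges V" using sub by blast
  then obtain x0 y0 where "{x0, y0} \<in> B" using e0 cg_edgesE by metis
  then obtain q0 where q0: "q0 \<in> V" "\<not> leaf B q0" using nonleaf_end ends by blast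
  obtain s0 where s0: "hull_edge V q0 s0" "{q0, s0} \<in> B"
    using tight_blocker_nonleaf(2)[OF gp t ns q0] by blast
  have "hull_path V B [q0, s0]"
    using s0 unfolding hull_path_def by (auto simp: hull_edge_def less_Suc_eq)
  then obtain ps where ps: "hull_path V B ps"
    and maxi: "\<And>qs. hull_path V B qs \<Longrightarrow> length qs \<le> length ps"
    using ex_maximal_hull_path[OF fin] by blast
  obtain k where k: "length ps = Suc k" using ps unfolding hull_path_def by (cases "length ps") auto
  have d: "distinct ps" and k1: "k \<ge> 1"
    and step: "\<And>i. i < k \<Longrightarrow> hull_edge V (ps ! i) (ps ! Suc i) \<and> {ps ! i, ps ! Suc i} \<in> B"
    using ps k unfolding hull_path_def by auto
  have c3: "card V \<ge> 3"
  proof (rule ccontr)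
    assume "\<not> ?thesis"
    then have "card B \<le> 1" using c by simp
    then have "e = e0" if "e \<in> B" for e
      using that e0 finite_subset[OF sub finite_cg_edges[OF fin]]
      by (metis card_le_Suc0_iff_eq One_nat_def)
    moreover obtain x where "x \<in> e0" "x \<in> V" using \<open>e0 \<in> cg_edges V\<close> cg_edgesE by blast
    ultimately show False using star_eqI[of x] by blast
  qed
  note end_leaf = maximal_hull_path_end_leaf[OF gp t c3 ns ps k maxi]
  define I where "I = {ps ! i | i. 0 < i \<and> i < k}"
  have I_nonleaf: "\<not> leaf B q" if q: "q \<in> I" for q
  proof
    assume l: "leaf B q"
    obtain i where i: "q = ps ! i" "0 < i" "i < k" using q unfolding I_def by blast
    then obtain j where j: "i = Suc j" by (cases i) auto
    have "{q, ps ! j} \<in> B" "{q, ps ! Suc i} \<in> B"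
      using step[of j] step[of i] i j by (auto simp: insert_commute)
    then have "ps ! j = ps ! Suc i" by (rule leaf_unique[OF l])
    then show False using d k i j by (simp add: nth_eq_iff_index_eq)
  qed
  have path_nbr: "{q, r} \<in> path_edges ps \<and> r \<in> set ps"
    if q: "q \<in> I" and h: "hull_edge V q r \<or> hull_edge V r q" for q r
  proof -
    obtain i where i: "q = ps ! i" "0 < i" "i < k" using q unfolding I_def by blast
    then obtain j where j: "i = Suc j" by (cases i) auto
    have "r = ps ! Suc i \<or> r = ps ! j"
      using h hull_edge_successor_unique[of V q r "ps ! Suc i"]
        hull_edge_predecessor_unique[of V r q "ps ! j"] step[of i] step[of j] i j by auto
    then show ?thesis using i j k unfolding path_edges_def
      by (auto simp: insert_commute intro: exI[of _ i] exI[of _ j])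
  qed
  have ps_cases: "x \<in> I \<or> x = ps ! 0 \<or> x = ps ! k" if "x \<in> set ps" for x
    using that k unfolding I_def by (auto simp: in_set_conv_nth less_Suc_eq)
  have nonleaf_nbr: "r \<in> I \<and> {q, r} \<in> path_edges ps" if "q \<in> I" "{q, r} \<in> B" "\<not> leaf B r" for q r
  proof -
    have "hull_edge V q r \<or> hull_edge V r q"
      using nonleaf_edge_is_hull_edge[OF gp t that(2)] I_nonleaf[OF that(1)] that(3) by blast
    then show ?thesis using path_nbr[OF that(1)] ps_cases[of r] that(3) end_leaf by blast
  qed
  have p01: "{ps ! 0, ps ! 1} \<in> B" using step[of 0] k1 by simp
  have "ps ! 1 \<in> I"
  proof -
    have "\<not> leaf B (ps ! 1)" using nonleaf_end[OF p01] end_leaf(1) by blast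
    then have "k \<noteq> 1" using end_leaf(2) by metis
    then show ?thesis using k1 unfolding I_def by (intro CollectI exI[of _ 1]) auto
  qed
  \<comment> \<open>Propagated along walks of \<open>B\<close> from \<open>ps ! 1\<close>; a walk
    that enters a leaf can only return to \<open>I\<close>.\<close>
  have cover: "v \<in> I \<or> (leaf B v \<and> (\<exists>q\<in>I. {v, q} \<in> B))" if "v \<in> V" for v
  proof -
    have "ps ! 1 \<in> V" using ends p01 by blast
    then have "linked B (ps ! 1) v" using con that by blast
    then show ?thesis
    proof (induction rule: linked_induct)
      case refl
      then show ?case using \<open>ps ! 1 \<in> I\<close> by blast
    next
      case (step x y)
      show ?case
      proof (cases "x \<in> I")
        case True
        then show ?thesis using nonleaf_nbr[OF True step.hyps(2)] step.hyps(2)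
          by (auto simp: insert_commute)
      next
        case False
        then obtain q where "leaf B x" "q \<in> I" "{x, q} \<in> B" using step.IH by blast
        then show ?thesis using leaf_unique[of B x q y] step.hyps(2) by blast
      qed
    qed
  qed
  have edge_end: "\<exists>q r. e = {q, r} \<and> q \<in> I" if "e \<in> B" for e
  proof -
    have "e \<in> cg_edges V" using sub that by blast
    then obtain x y where xy: "e = {x, y}" "x \<in> V" "y \<in> V" "x \<noteq> y" by (rule cg_edgesE)
    then have "x \<in> I \<or> y \<in> I" using nonleaf_end[of x y] cover[of x] cover[of y] that by blast
    then show ?thesis using xy(1) by (metis insert_commute)
  qed
  have on_path: "{q, r} \<in> path_edges ps" if "q \<in> I" "{q, r} \<in> B" and r: "r \<in> set ps" for q r
  proof -
    consider "r \<in> I" | "r = ps ! 0" | "r = ps ! k" using ps_cases[OF r] by blast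
    then show ?thesis
    proof cases
      case 1
      then show ?thesis using nonleaf_nbr[OF that(1,2)] I_nonleaf by blast
    next
      case 2
      have "{ps ! 0, q} \<in> B" using that 2 by (simp add: insert_commute)
      then have "q = ps ! 1" using leaf_unique[OF end_leaf(1) _ p01] by blast
      then show ?thesis using 2 k k1 unfolding path_edges_def
        by (auto simp: insert_commute intro: exI[of _ 0])
    next
      case 3
      obtain j where j: "k = Suc j" using k1 by (cases k) auto
      have "{ps ! k, q} \<in> B" using that 3 by (simp add: insert_commute)
      moreover have "{ps ! k, ps ! j} \<in> B" using step[of j] j by (simp add: insert_commute)
      ultimately have "q = ps ! j" using leaf_unique[OF end_leaf(2)] by blast
      then show ?thesis using 3 k j unfolding path_edges_def by auto
    qed
  qed
  have inner: "set (butlast (tl ps)) = I" unfolding set_butlast_tl I_def k by simp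
  have 1: "{e \<in> B. boundary_edge V e} = path_edges ps"
  proof
    show "path_edges ps \<subseteq> {e \<in> B. boundary_edge V e}"
    proof
      fix e assume e: "e \<in> path_edges ps"
      then obtain i where i: "i < k" "e = {ps ! i, ps ! Suc i}" using k unfolding path_edges_def by auto
      then show "e \<in> {e \<in> B. boundary_edge V e}"
        using step[OF i(1)] boundary_edge_iff[OF gp ends] by blast
    qed
    show "{e \<in> B. boundary_edge V e} \<subseteq> path_edges ps"
    proof
      fix e assume "e \<in> {e \<in> B. boundary_edge V e}"
      then have e: "e \<in> B" "boundary_edge V e" by auto
      then obtain q r where qr: "e = {q, r}" "q \<in> I" using edge_end by blast
      then have "hull_edge V q r \<or> hull_edge V r q" using e boundary_edge_iff[OF gp ends] by blast
      then show "e \<in> path_edges ps" using path_nbr qr by blast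
    qed
  qed
  have 2: "\<exists>!e. e \<in> B \<and> v \<in> e" if "v \<in> V - set ps" for v
  proof -
    have "v \<notin> I" using that k unfolding I_def by auto
    then have "leaf B v" using cover[of v] that by blast
    then show ?thesis unfolding leaf_def .
  qed
  have 3: "e \<in> path_edges ps \<or> (\<exists>v\<in>V - set ps. \<exists>q\<in>set (butlast (tl ps)). e = {v, q})"
    if e: "e \<in> B" for e
  proof -
    obtain q r where qr: "e = {q, r}" "q \<in> I" using edge_end[OF e] by blast
    then have "r \<in> V" using ends e by blast
    then show ?thesis using on_path[OF qr(2), of r] qr e inner by (auto simp: insert_commute)
  qed
  have 4: "\<not> line_crosses e f" if "e \<in> B" "f \<in> B" for e f
  proof -
    have "e \<in> cg_edges V" "f \<in> cg_edges V" using sub that by blast+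
    then obtain a b x y where ab: "e = {a, b}" "a \<in> V" "b \<in> V" "a \<noteq> b"
      and xy: "f = {x, y}" "x \<in> V" "y \<in> V" by (elim cg_edgesE)
    have "{y, x} \<in> B" using that xy by (simp add: insert_commute)
    then have "\<not> orient a b x * orient a b y < 0"
      using tight_blocker_line[OF gp t, of a b x y] tight_blocker_line[OF gp t, of a b y x] that ab xy
      by (auto simp: mult_less_0_iff)
    then show ?thesis using line_crosses_iff[OF gp] ab xy by blast
  qed
  show "comb V B"
    unfolding comb_def
  proof (intro conjI exI[of _ ps] ballI)
    show "length ps \<ge> 2" using ps unfolding hull_path_def by blast
    show "B \<subseteq> cg_edges V" by (rule sub)
    show "simple_graph B" by (rule tight_blocker_tree(2)[OF gp t])
    show "set ps \<subseteq> V" by (rule hull_path_subset[OF ps])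
  qed (rule d 1 2 3 4; assumption?)+
qed

section \<open>Combs block simple spanning trees\<close>

text \<open>\<open>p 0, ..., p k\<close> is the spine, and \<open>phi v\<close> is the index of the spine vertex that v is,
  or is attached to.\<close>
locale oriented_comb =
  fixes V :: "point set" and B :: "edge set" and p :: "nat \<Rightarrow> point" and k :: nat
    and phi :: "point \<Rightarrow> nat"
  assumes gp: "general_position V"
    and line: "\<And>a b x y. {a, b} \<in> B \<Longrightarrow> {x, y} \<in> B \<Longrightarrow> x \<notin> {a, b} \<Longrightarrow> y \<notin> {a, b} \<Longrightarrow>
      orient a b x * orient a b y > 0"
    and k: "k \<ge> 1"
    and hull: "\<And>i. i < k \<Longrightarrow> hull_edge V (p i) (p (Suc i))"
    and spine: "\<And>i. i < k \<Longrightarrow> {p i, p (Suc i)} \<in> B"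
    and phi_le: "\<And>v. v \<in> V \<Longrightarrow> phi v \<le> k"
    and phi_spine: "\<And>i. i \<le> k \<Longrightarrow> phi (p i) = i"
    and phi_tooth: "\<And>v. v \<in> V \<Longrightarrow> v \<noteq> p (phi v) \<Longrightarrow> 0 < phi v \<and> phi v < k \<and> {v, p (phi v)} \<in> B"
begin

lemma spine_in_V: "i \<le> k \<Longrightarrow> p i \<in> V"
  using hull[of i] hull[of "i - 1"] k unfolding hull_edge_def by (cases "i = k") auto

lemma hull_pos: "i < k \<Longrightarrow> x \<in> V \<Longrightarrow> phi x \<noteq> i \<Longrightarrow> phi x \<noteq> Suc i \<Longrightarrow> orient (p i) (p (Suc i)) x > 0"
  using hull[of i] phi_spine[of i] phi_spine[of "Suc i"] unfolding hull_edge_def by auto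

lemma hull_pos': "i < k \<Longrightarrow> x \<in> V \<Longrightarrow> x \<noteq> p i \<Longrightarrow> x \<noteq> p (Suc i) \<Longrightarrow> orient (p i) (p (Suc i)) x > 0"
  using hull[of i] unfolding hull_edge_def by auto

text \<open>The hull edge leaving the foot of the tooth fixes the side of the next spine vertex.
  Further spine vertices stay on that side because no spine edge crosses the line of the
  tooth.\<close>

lemma tooth_right_spine:
  assumes u: "u \<in> V" "u \<noteq> p (phi u)" and j: "phi u < j" "j \<le> k"
  shows "orient (p (phi u)) u (p j) < 0"
proof -
  have t: "phi u < k" "{p (phi u), u} \<in> B" using phi_tooth[OF u] by (auto simp: insert_commute)
  have "Suc (phi u) \<le> j" using j by simp
  then show ?thesis using j(2)
  proof (induction j rule: dec_induct)
    case base
    have "u \<noteq> p (Suc (phi u))" using phi_spine[of "Suc (phi u)"] t by auto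
    then show ?case
      using hull_pos'[OF t(1) u(1) u(2)] orient_swap[of "p (phi u)" u "p (Suc (phi u))"] by simp
  next
    case (step j)
    have "orient (p (phi u)) u (p j) * orient (p (phi u)) u (p (Suc j)) > 0"
    proof (rule line[OF t(2) spine[of j]])
      show "p j \<notin> {p (phi u), u}" "p (Suc j) \<notin> {p (phi u), u}"
        using phi_spine[of j] phi_spine[of "Suc j"] phi_spine[of "phi u"] step t by auto
    qed (use step in simp)
    then show ?case using step by (auto simp: zero_less_mult_iff)
  qed
qed

text \<open>Mirror image of \<open>tooth_right_spine\<close>, by induction down the spine.\<close>

lemma tooth_left_spine:
  assumes u: "u \<in> V" "u \<noteq> p (phi u)" and j: "j < phi u"
  shows "orient (p (phi u)) u (p j) > 0"
proof -
  have t: "phi u < k" "{p (phi u), u} \<in> B" using phi_tooth[OF u] by (auto simp: insert_commute)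
  obtain m where m: "phi u = Suc m" using j by (cases "phi u") auto
  have "j \<le> m" using j m by simp
  then show ?thesis
  proof (induction j rule: inc_induct)
    case base
    have "u \<noteq> p m" using phi_spine[of m] t m by auto
    then have "orient (p m) (p (phi u)) u > 0" using hull_pos'[of m u] t u m by simp
    then show ?case using orient_rotate[of "p m" "p (phi u)" u] by simp
  next
    case (step j)
    have "orient (p (phi u)) u (p j) * orient (p (phi u)) u (p (Suc j)) > 0"
    proof (rule line[OF t(2) spine[of j]])
      show "p j \<notin> {p (phi u), u}" "p (Suc j) \<notin> {p (phi u), u}"
        using phi_spine[of j] phi_spine[of "Suc j"] phi_spine[of "phi u"] step t m by auto
    qed (use step m t in simp)
    then show ?case using step by (auto simp: zero_less_mult_iff)
  qed
qed

lemma tooth_same_side: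
  assumes u: "u \<in> V" "u \<noteq> p (phi u)" and x: "x \<in> V" "phi x \<noteq> phi u" "x \<noteq> p (phi x)"
  shows "orient (p (phi u)) u x * orient (p (phi u)) u (p (phi x)) > 0"
proof (rule line)
  show "{p (phi u), u} \<in> B" "{x, p (phi x)} \<in> B"
    using phi_tooth[OF u] phi_tooth[OF x(1,3)] by (auto simp: insert_commute)
  show "x \<notin> {p (phi u), u}" "p (phi x) \<notin> {p (phi u), u}"
    using x phi_spine[OF phi_le[OF u(1)]] phi_spine[OF phi_le[OF x(1)]] by auto
qed

lemma tooth_right:
  assumes u: "u \<in> V" "u \<noteq> p (phi u)" and x: "x \<in> V" "phi u < phi x"
  shows "orient (p (phi u)) u x < 0"
  using tooth_right_spine[OF u x(2) phi_le[OF x(1)]] tooth_same_side[OF u x(1)] x(2)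
  by (cases "x = p (phi x)") (auto simp: zero_less_mult_iff)

lemma tooth_left:
  assumes u: "u \<in> V" "u \<noteq> p (phi u)" and x: "x \<in> V" "phi x < phi u"
  shows "orient (p (phi u)) u x > 0"
  using tooth_left_spine[OF u x(2)] tooth_same_side[OF u x(1)] x(2)
  by (cases "x = p (phi x)") (auto simp: zero_less_mult_iff)

text \<open>Induction moves the first vertex backwards along the spine. If the turn a, c, d failed,
  d would lie in the triangle abc, although the hull edge entering d has b and c on its closed left
  side and a strictly left: all terms of \<open>orient_triangle_identity\<close> would be
  nonnegative and one positive.\<close>

lemma spine_convex:
  assumes "m < i" "i < j" "j \<le> k"
  shows "orient (p m) (p i) (p j) > 0"
proof -
  obtain l where l: "i = Suc l" using assms(1) by (cases i) auto
  obtain h where h: "j = Suc h" using assms(2) by (cases j) auto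
  have "m \<le> l" using assms(1) l by simp
  then show ?thesis
  proof (induction m rule: inc_induct)
    case base
    show ?case using hull_pos[of l "p j"] spine_in_V[of j] phi_spine[of j] assms l by auto
  next
    case (step n)
    let ?a = "p n" and ?b = "p (Suc n)" and ?c = "p i" and ?d = "p j" and ?e = "p h"
    have V: "?a \<in> V" "?b \<in> V" "?c \<in> V" "?d \<in> V" using spine_in_V step assms l by auto
    have ph: "phi ?a = n" "phi ?b = Suc n" "phi ?c = i" "phi ?d = j"
      using phi_spine step assms l by auto
    have abd: "orient ?a ?b ?d > 0" using hull_pos[of n ?d] V ph step assms l by auto
    have e: "orient ?e ?d x > 0" if "x \<in> V" "phi x \<noteq> h" "phi x \<noteq> j" for x
      using hull_pos[of h x] that assms h by auto
    have ea: "orient ?e ?d ?a > 0" "orient ?e ?d ?b > 0" using e V ph step assms l h by auto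
    have ec: "orient ?e ?d ?c \<ge> 0"
    proof (cases "h = i")
      case False
      then show ?thesis using e[OF V(3)] ph assms by auto
    qed simp
    show ?case
    proof (rule ccontr)
      assume "\<not> ?case"
      then have "orient ?c ?a ?d \<ge> 0" using orient_flip[of ?c ?a ?d] by simp
      then have "orient ?c ?a ?d * orient ?e ?d ?b \<ge> 0" using ea by simp
      moreover have "orient ?b ?c ?d * orient ?e ?d ?a > 0" using step.IH ea by simp
      moreover have "orient ?a ?b ?d * orient ?e ?d ?c \<ge> 0" using abd ec by simp
      ultimately show False using orient_triangle_identity[of ?b ?c ?d ?e ?a] by linarith
    qed
  qed
qed

section \<open>Angular order around a spine vertex\<close>

text \<open>Provides a side of the quadrilateral in \<open>angular_order\<close>: the hull edge
  leaving \<open>w\<close> if \<open>w\<close> is on the spine, its tooth otherwise. For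
  \<open>w = p (i - 1)\<close> the hull edge would end at \<open>p i\<close>, too far along.\<close>

lemma left_support:
  assumes w: "w \<in> V" "phi w < i" "w \<noteq> p (i - 1)" and i: "i \<le> k"
  obtains m where "m < i" "\<And>x. x \<in> V \<Longrightarrow> i \<le> phi x \<Longrightarrow> orient w (p m) x > 0"
proof (cases "w = p (phi w)")
  case True
  have lt: "Suc (phi w) < i"
    using w True by (metis One_nat_def diff_Suc_1 less_antisym not_less_eq Suc_lessI)
  have "orient w (p (Suc (phi w))) x > 0" if "x \<in> V" "i \<le> phi x" for x
    using hull_pos[of "phi w" x] that lt i True by auto
  then show ?thesis using that lt by blast
next
  case False
  have "orient w (p (phi w)) x > 0" if "x \<in> V" "i \<le> phi x" for x
    using tooth_right[OF w(1) False that(1)] that(2) w(2) orient_flip[of w "p (phi w)" x] by simp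
  then show ?thesis using that w(2) by blast
qed

lemma right_support:
  assumes v: "v \<in> V" "i < phi v" "v \<noteq> p (Suc i)"
  obtains j where "i < j" "j \<le> k" "\<And>x. x \<in> V \<Longrightarrow> phi x \<le> i \<Longrightarrow> orient (p j) v x > 0"
proof (cases "v = p (phi v)")
  case True
  obtain j where j: "phi v = Suc j" using v(2) by (cases "phi v") auto
  have le: "Suc j \<le> k" using phi_le[OF v(1)] j by simp
  have "j \<noteq> i" using v(3) True j by auto
  then have lt: "i < j" using v(2) j by simp
  have "orient (p j) v x > 0" if "x \<in> V" "phi x \<le> i" for x
    using hull_pos[of j x] that lt le True j by auto
  then show ?thesis using that[of j] lt le by auto
next
  case False
  have "orient (p (phi v)) v x > 0" if "x \<in> V" "phi x \<le> i" for x
    using tooth_left[OF v(1) False that(1)] that(2) v(2) by simp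
  then show ?thesis using that[of "phi v"] v(2) phi_le[OF v(1)] by blast
qed

text \<open>Vertices attached at \<open>p i\<close> or next to it on the spine are handled by a
  tooth or a hull edge at \<open>p i\<close>. Otherwise the supports give spine vertices A before
  and B after X = \<open>p i\<close> such that A, B, v, w form a convex quadrilateral. X lies right
  of AB by \<open>spine_convex\<close> but left of Bv and wA, so it lies left of vw.\<close>

lemma angular_order:
  assumes i: "i \<le> k" and v: "v \<in> V" "v \<noteq> p i" "i \<le> phi v" and w: "w \<in> V" "w \<noteq> p i" "phi w \<le> i"
    and ne: "phi w < phi v"
  shows "orient (p i) v w > 0"
proof -
  consider "phi w = i" | "phi v = i" | "phi w < i" "i < phi v" "w = p (i - 1)"
    | "phi w < i" "i < phi v" "v = p (Suc i)"
    | "phi w < i" "i < phi v" "w \<noteq> p (i - 1)" "v \<noteq> p (Suc i)"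
    using v(3) w(3) by fastforce
  then show ?thesis
  proof cases
    case 1
    then show ?thesis using tooth_right[of w v] w v ne orient_swap[of "p i" v w] by auto
  next
    case 2
    then show ?thesis using tooth_left[of v w] w v ne by auto
  next
    case 3
    then have "orient (p (i - 1)) (p i) v > 0" using hull_pos[of "i - 1" v] v i by auto
    then show ?thesis using 3 orient_rotate[of "p (i - 1)" "p i" v] by simp
  next
    case 4
    have "i < k" using 4 phi_le[OF v(1)] by simp
    then show ?thesis using hull_pos[of i w] 4 w by auto
  next
    case 5
    let ?X = "p i"
    obtain m where m: "m < i" and Lm: "\<And>x. x \<in> V \<Longrightarrow> i \<le> phi x \<Longrightarrow> orient w (p m) x > 0"
      using left_support[OF w(1) 5(1,3) i] by blast
    obtain j where j: "i < j" "j \<le> k" and Rj: "\<And>x. x \<in> V \<Longrightarrow> phi x \<le> i \<Longrightarrow> orient (p j) v x > 0"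
      using right_support[OF v(1) 5(2,4)] by blast
    let ?A = "p m" and ?B = "p j"
    have V: "?A \<in> V" "?B \<in> V" "?X \<in> V" using spine_in_V m j i by auto
    have ph: "phi ?A = m" "phi ?B = j" "phi ?X = i" using phi_spine m j i by auto
    have ABX: "orient ?A ?B ?X < 0" using spine_convex[OF m j] orient_swap[of ?A ?B ?X] by simp
    have ABC: "orient ?A ?B v > 0" using Rj[OF V(1)] ph m orient_rotate[of ?A ?B v] by simp
    have ABD: "orient ?A ?B w > 0" using Lm[OF V(2)] ph j orient_rotate[of w ?A ?B] by simp
    have DAC: "orient w ?A v > 0" using Lm[OF v(1)] v by simp
    have CDA: "orient v w ?A > 0" using DAC orient_rotate[of v w ?A] orient_rotate[of w ?A v] by simp
    have CDB: "orient v w ?B > 0" using Rj[OF w(1)] w orient_rotate[of ?B v w] by simp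
    have BCX: "orient ?B v ?X > 0" using Rj[OF V(3)] ph by simp
    have DAX: "orient w ?A ?X > 0" using Lm[OF V(3)] ph by simp
    have "orient v w ?B * orient w ?A v * orient ?A ?B ?X < 0"
      using CDB DAC ABX by (simp add: mult_pos_neg)
    moreover have "orient v w ?A * orient ?A ?B w * orient ?B v ?X > 0" using CDA ABD BCX by simp
    moreover have "orient v w ?B * orient ?A ?B v * orient w ?A ?X > 0" using CDB ABC DAX by simp
    ultimately have "orient v w ?X * (orient ?A ?B v * orient ?A ?B w) > 0"
      using orient_quad_identity[of v w ?X ?A ?B] by (simp add: mult.assoc)
    moreover have "orient ?A ?B v * orient ?A ?B w > 0" using ABC ABD by simp
    ultimately have "orient v w ?X > 0" using zero_less_mult_pos2 by blast
    then show ?thesis using orient_rotate[of ?X v w] by simp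
  qed
qed

text \<open>The ends \<open>v\<close> and \<open>w\<close> of the two chosen edges lie left of the
  spine edge from \<open>p i\<close> to \<open>p (Suc i)\<close>. By \<open>angular_order\<close> at
  both of its ends, each chosen edge separates, by its line, the ends of the other.\<close>

lemma not_simple_spanning:
  assumes T: "T \<subseteq> cg_edges V" "T \<inter> B = {}" "simple_graph T"
    and spanning: "\<And>v. v \<in> V \<Longrightarrow> \<exists>w. {v, w} \<in> T"
  shows False
proof -
  have ends: "x \<in> V" "y \<in> V" "x \<noteq> y" if "{x, y} \<in> T" for x y
    using subsetD[OF T(1) that] doubleton_in_cg_edges by auto
  have notB: "{x, y} \<notin> B" "{y, x} \<notin> B" if "{x, y} \<in> T" for x y
    using T(2) that by (auto simp: insert_commute)
  \<comment> \<open>A vertex attached at \<open>p i\<close> is joined to it by an edge of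
    \<open>B\<close>, so every edge of \<open>T\<close> at \<open>p i\<close> points strictly right
    or strictly left.\<close>
  have phi_ne: "phi v \<noteq> i" if "i \<le> k" "{p i, v} \<in> T" for i v
    using phi_tooth[of v] ends[OF that(2)] notB[OF that(2)] by auto
  define right where "right i \<longleftrightarrow> (\<exists>v. {p i, v} \<in> T \<and> phi v > i)" for i
  have "right 0"
    using spanning[OF spine_in_V[of 0]] phi_ne[of 0] unfolding right_def by auto
  moreover have "\<not> right k" unfolding right_def using ends(2) phi_le by (meson not_le)
  ultimately obtain i where i: "i < k" "right i" "\<not> right (Suc i)"
  proof -
    \<comment> \<open>Discrete intermediate value: \<open>right\<close> holds at 0 and fails at
      \<open>k\<close>.\<close>
    have "\<exists>i<k. right i \<and> \<not> right (Suc i)"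
    proof (rule ccontr)
      assume no: "\<not> ?thesis"
      have "right i" if "i \<le> k" for i
        using that by (induction i) (use no \<open>right 0\<close> in auto)
      then show False using \<open>\<not> right k\<close> by blast
    qed
    then show ?thesis using that by blast
  qed
  obtain v where v: "{p i, v} \<in> T" "i < phi v" using i(2) unfolding right_def by blast
  obtain w where w: "{p (Suc i), w} \<in> T" using spanning[OF spine_in_V[of "Suc i"]] i(1) by auto
  have "\<not> phi w > Suc i" using w i(3) unfolding right_def by blast
  then have phw: "phi w \<le> i" using phi_ne[OF _ w] i(1) by simp
  have ne: "v \<noteq> p (Suc i)" "w \<noteq> p i" using notB[OF v(1)] notB[OF w] spine[OF i(1)] by auto
  have ne': "v \<noteq> p i" "w \<noteq> p (Suc i)" using ends(3)[OF v(1)] ends(3)[OF w] by auto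
  have V: "v \<in> V" "w \<in> V" using ends(2) v w by auto
  have o1: "orient (p i) v w > 0" using angular_order[of i v w] i(1) V ne ne' v(2) phw by auto
  have o2: "orient (p (Suc i)) v w > 0"
    using angular_order[of "Suc i" v w] i(1) V ne ne' v(2) phw by auto
  have o3: "orient (p i) (p (Suc i)) v > 0" "orient (p i) (p (Suc i)) w > 0"
    using hull_pos'[OF i(1)] V ne ne' by auto
  have "edges_cross {p i, v} {p (Suc i), w}"
  proof (rule opposite_sides_cross)
    show "orient (p i) v (p (Suc i)) * orient (p i) v w < 0"
      using o1 o3(1) orient_swap[of "p i" v "p (Suc i)"] by (simp add: mult_neg_pos)
    show "orient (p (Suc i)) w (p i) * orient (p (Suc i)) w v < 0"
      using o2 o3(2) orient_rotate[of "p i" "p (Suc i)" w] orient_swap[of "p (Suc i)" v w]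
      by (simp add: mult_pos_neg)
  qed
  then show False using T(3) v(1) w unfolding simple_graph_def by blast
qed

end

section \<open>From combs to oriented combs\<close>

lemma combE:
  assumes "comb V B"
  obtains ps where "length ps \<ge> 2" "distinct ps" "set ps \<subseteq> V"
    "{e \<in> B. boundary_edge V e} = path_edges ps"
    "\<forall>v\<in>V - set ps. \<exists>!e. e \<in> B \<and> v \<in> e"
    "\<forall>e\<in>B. e \<in> path_edges ps \<or>
      (\<exists>v \<in> V - set ps. \<exists>q \<in> set (butlast (tl ps)). e = {v, q})"
    "\<forall>e\<in>B. \<forall>f\<in>B. \<not> line_crosses e f" "B \<subseteq> cg_edges V"
  using assms unfolding comb_def by (elim conjE exE) (rule that; assumption)

text \<open>Every edge is a spine edge or the only edge at some vertex off the spine, which leaves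
  at most |V| - 1. The reverse inequality will follow from blocking.\<close>

lemma comb_card:
  assumes fin: "finite V" and c: "comb V B"
  shows "card B + 1 \<le> card V"
proof -
  obtain ps where ps: "length ps \<ge> 2" "distinct ps" "set ps \<subseteq> V"
    and uniq: "\<forall>v\<in>V - set ps. \<exists>!e. e \<in> B \<and> v \<in> e"
    and edges: "\<forall>e\<in>B. e \<in> path_edges ps \<or>
      (\<exists>v \<in> V - set ps. \<exists>q \<in> set (butlast (tl ps)). e = {v, q})"
    using c by (rule combE)
  let ?t = "\<lambda>v. THE e. e \<in> B \<and> v \<in> e"
  let ?s = "\<lambda>i. {ps ! i, ps ! Suc i}"
  have P: "path_edges ps = ?s ` {..<length ps - 1}" unfolding path_edges_def by auto
  have "B \<subseteq> ?s ` {..<length ps - 1} \<union> ?t ` (V - set ps)"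
  proof
    fix e assume e: "e \<in> B"
    show "e \<in> ?s ` {..<length ps - 1} \<union> ?t ` (V - set ps)"
    proof (cases "e \<in> path_edges ps")
      case False
      then obtain v q where v: "v \<in> V - set ps" "e = {v, q}" using edges e by blast
      have "?t v = e" by (rule the1_equality[OF bspec[OF uniq v(1)]]) (use e v in auto)
      then show ?thesis using v(1) by blast
    qed (use P in blast)
  qed
  then have "card B \<le> card (?s ` {..<length ps - 1} \<union> ?t ` (V - set ps))"
    using fin by (intro card_mono) auto
  also have "\<dots> \<le> card (?s ` {..<length ps - 1}) + card (?t ` (V - set ps))" by (rule card_Un_le)
  also have "\<dots> \<le> (length ps - 1) + card (V - set ps)"
    using card_image_le[of "{..<length ps - 1}" ?s] card_image_le[of "V - set ps" ?t] fin by simp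
  also have "card (V - set ps) = card V - length ps"
    using card_Diff_subset[OF _ ps(3)] distinct_card[OF ps(2)] by simp
  finally show ?thesis using ps(1) card_mono[OF fin ps(3)] distinct_card[OF ps(2)] by simp
qed

text \<open>The definition of a comb does not fix the direction of the spine. Consecutive hull edges
  of opposite direction would share their head or their tail, and uniqueness would identify two
  spine vertices at distance two.\<close>

lemma spine_oriented:
  assumes "distinct ps" and k: "length ps = Suc k"
    and h: "\<And>i. i < k \<Longrightarrow> hull_edge V (ps ! i) (ps ! Suc i) \<or> hull_edge V (ps ! Suc i) (ps ! i)"
  shows "(\<forall>i<k. hull_edge V (ps ! i) (ps ! Suc i)) \<or> (\<forall>i<k. hull_edge V (ps ! Suc i) (ps ! i))"
proof -
  have neq: "ps ! i \<noteq> ps ! Suc (Suc i)" if "Suc i < k" for i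
    using assms(1) k that by (simp add: nth_eq_iff_index_eq)
  have fwd: "hull_edge V (ps ! Suc i) (ps ! Suc (Suc i))"
    if "Suc i < k" "hull_edge V (ps ! i) (ps ! Suc i)" for i
    using h[OF that(1)] hull_edge_predecessor_unique[OF that(2)] neq[OF that(1)] by blast
  have bwd: "hull_edge V (ps ! Suc (Suc i)) (ps ! Suc i)"
    if "Suc i < k" "hull_edge V (ps ! Suc i) (ps ! i)" for i
    using h[OF that(1)] hull_edge_successor_unique[OF that(2)] neq[OF that(1)] by blast
  have "hull_edge V (ps ! i) (ps ! Suc i)" if "hull_edge V (ps ! 0) (ps ! Suc 0)" "i < k" for i
    using that(2) by (induction i) (use that(1) fwd in auto)
  moreover have "hull_edge V (ps ! Suc i) (ps ! i)" if "hull_edge V (ps ! Suc 0) (ps ! 0)" "i < k" for i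
    using that(2) by (induction i) (use that(1) bwd in auto)
  ultimately show ?thesis using h[of 0] by (cases "k = 0") auto
qed

lemma comb_oriented:
  assumes gp: "general_position V" and c: "comb V B"
  obtains p k phi where "oriented_comb V B p k phi"
proof -
  note result = that
  obtain ps where ps: "length ps \<ge> 2" "distinct ps" "set ps \<subseteq> V"
    and spine: "{e \<in> B. boundary_edge V e} = path_edges ps"
    and uniq: "\<forall>v\<in>V - set ps. \<exists>!e. e \<in> B \<and> v \<in> e"
    and edges: "\<forall>e\<in>B. e \<in> path_edges ps \<or>
      (\<exists>v \<in> V - set ps. \<exists>q \<in> set (butlast (tl ps)). e = {v, q})"
    and lines: "\<forall>e\<in>B. \<forall>f\<in>B. \<not> line_crosses e f" and sub: "B \<subseteq> cg_edges V"
    using c by (rule combE)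
  obtain k where k: "length ps = Suc k" "k \<ge> 1" using ps(1) by (cases "length ps") auto
  have ends: "x \<in> V" "y \<in> V" "x \<noteq> y" if "{x, y} \<in> B" for x y
    using subsetD[OF sub that] doubleton_in_cg_edges by auto
  have step: "{ps ! i, ps ! Suc i} \<in> B" "boundary_edge V {ps ! i, ps ! Suc i}" if "i < k" for i
  proof -
    have "{ps ! i, ps ! Suc i} \<in> path_edges ps" unfolding path_edges_def using that k by auto
    then show "{ps ! i, ps ! Suc i} \<in> B" "boundary_edge V {ps ! i, ps ! Suc i}" using spine by blast+
  qed
  have h: "hull_edge V (ps ! i) (ps ! Suc i) \<or> hull_edge V (ps ! Suc i) (ps ! i)" if "i < k" for i
    using step[OF that] boundary_edge_iff[OF gp ends[OF step(1)[OF that]]] by blast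
  have line: "orient a b x * orient a b y > 0"
    if e: "{a, b} \<in> B" and f: "{x, y} \<in> B" and n: "x \<notin> {a, b}" "y \<notin> {a, b}" for a b x y
  proof -
    have "\<not> orient a b x * orient a b y < 0"
      using lines[rule_format, OF e f] line_crosses_iff[OF gp ends(1,2)[OF e] ends(1,2)[OF f] ends(3)[OF e]] by blast
    moreover have "orient a b x \<noteq> 0" "orient a b y \<noteq> 0"
      using general_position_orient[OF gp ends(1,2)[OF e]] ends[OF e] ends[OF f] n by auto
    ultimately show ?thesis by (metis linorder_neqE_linordered_idom mult_eq_0_iff)
  qed
  have teeth: "\<exists>i. 0 < i \<and> i < k \<and> {v, ps ! i} \<in> B" if v: "v \<in> V - set ps" for v
  proof -
    obtain e where e: "e \<in> B" "v \<in> e" using bspec[OF uniq v] by blast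
    have "e \<notin> path_edges ps" using e(2) v k unfolding path_edges_def by auto
    then obtain u q where u: "u \<in> V - set ps" "q \<in> set (butlast (tl ps))" "e = {u, q}"
      using bspec[OF edges e(1)] \<open>e \<notin> path_edges ps\<close> by blast
    obtain i where i: "q = ps ! i" "0 < i" "i < k" using u(2) k unfolding set_butlast_tl by auto
    then have "q \<in> set ps" using k by simp
    then show ?thesis using e u v i by auto
  qed
  \<comment> \<open>Stated for any enumeration \<open>p\<close> of the spine, since a clockwise
    spine is read backwards, as \<open>ps ! (k - i)\<close>.\<close>
  have main: thesis
    if p: "p ` {..k} = set ps" "inj_on p {..k}"
      and hp: "\<And>i. i < k \<Longrightarrow> hull_edge V (p i) (p (Suc i)) \<and> {p i, p (Suc i)} \<in> B"
      and tp: "\<And>v. v \<in> V - set ps \<Longrightarrow> \<exists>i. 0 < i \<and> i < k \<and> {v, p i} \<in> B" for p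
  proof -
    have "\<forall>v\<in>V. \<exists>i. i \<le> k \<and> (v = p i \<or> (v \<notin> set ps \<and> 0 < i \<and> i < k \<and> {v, p i} \<in> B))"
    proof
      fix v assume v: "v \<in> V"
      show "\<exists>i. i \<le> k \<and> (v = p i \<or> (v \<notin> set ps \<and> 0 < i \<and> i < k \<and> {v, p i} \<in> B))"
      proof (cases "v \<in> set ps")
        case True
        then show ?thesis using p(1) by (metis atMost_iff imageE)
      next
        case False
        then show ?thesis using tp[of v] v by (metis DiffI less_imp_le)
      qed
    qed
    then obtain phi where phi: "\<forall>v\<in>V. phi v \<le> k \<and>
      (v = p (phi v) \<or> (v \<notin> set ps \<and> 0 < phi v \<and> phi v < k \<and> {v, p (phi v)} \<in> B))"
      using bchoice[of V] by metis
    have "oriented_comb V B p k phi"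
    proof
      show "phi (p i) = i" if i: "i \<le> k" for i
      proof -
        have "p i \<in> set ps" using p(1) i by blast
        then have "p i = p (phi (p i))" "phi (p i) \<le> k" using phi ps(3) by blast+
        then show ?thesis using inj_onD[OF p(2), of i "phi (p i)"] i by simp
      qed
    qed (use gp line k(2) hp phi in blast)+
    then show thesis by (rule result)
  qed
  from spine_oriented[OF ps(2) k(1) h] show thesis
  proof
    assume a: "\<forall>i<k. hull_edge V (ps ! i) (ps ! Suc i)"
    show thesis
    proof (rule main[of "(!) ps"])
      show "(!) ps ` {..k} = set ps" using k by (auto simp: set_conv_nth less_Suc_eq_le)
      show "inj_on ((!) ps) {..k}" using ps(2) k by (auto simp: inj_on_def nth_eq_iff_index_eq)
    qed (use a step teeth in auto)
  next
    assume a: "\<forall>i<k. hull_edge V (ps ! Suc i) (ps ! i)"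
    let ?p = "\<lambda>i. ps ! (k - i)"
    show thesis
    proof (rule main[of ?p])
      have "x \<in> ?p ` {..k}" if x: "x \<in> set ps" for x
      proof -
        obtain i where "i \<le> k" "x = ps ! i" using x k by (auto simp: in_set_conv_nth less_Suc_eq_le)
        then show ?thesis by (intro image_eqI[of _ _ "k - i"]) auto
      qed
      then show "?p ` {..k} = set ps" using k by auto
      show "inj_on ?p {..k}" using ps(2) k by (auto simp: inj_on_def nth_eq_iff_index_eq)
      show "hull_edge V (?p i) (?p (Suc i)) \<and> {?p i, ?p (Suc i)} \<in> B" if i: "i < k" for i
      proof -
        have "Suc (k - Suc i) = k - i" "k - Suc i < k" using i by auto
        then show ?thesis using a[rule_format, of "k - Suc i"] step(1)[of "k - Suc i"]
          by (simp add: insert_commute)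
      qed
      show "\<exists>i. 0 < i \<and> i < k \<and> {v, ?p i} \<in> B" if v: "v \<in> V - set ps" for v
      proof -
        obtain i where i: "0 < i" "i < k" "{v, ps ! i} \<in> B" using teeth[OF v] by blast
        then show ?thesis by (intro exI[of _ "k - i"]) auto
      qed
    qed
  qed
qed

lemma comb_blocks:
  assumes gp: "general_position V" and c: "comb V B" and V: "card V \<ge> 2"
  shows "\<not> contains_simple_spanning (- B) V"
proof
  assume "contains_simple_spanning (- B) V"
  then obtain T where T: "T \<subseteq> - B \<inter> cg_edges V" "simple_graph T" "connected_on V T"
    unfolding contains_simple_spanning_def by blast
  obtain p k phi where "oriented_comb V B p k phi" using comb_oriented[OF gp c] .
  then interpret oriented_comb V B p k phi .
  have "\<exists>w. {v, w} \<in> T" if v: "v \<in> V" for v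
  proof -
    have "V \<noteq> {v}" using V by auto
    then obtain u where "u \<in> V" "v \<noteq> u" using v by blast
    then show ?thesis using connected_on_ex_edge[OF T(3) v] by blast
  qed
  then show False using not_simple_spanning[of T] T by blast
qed

section \<open>Minimality and the equivalence\<close>

lemma star_blocks:
  assumes "c \<in> V" "card V \<ge> 2"
  shows "\<not> contains_simple_spanning (- star V c) V"
proof
  assume "contains_simple_spanning (- star V c) V"
  then obtain T where T: "T \<subseteq> - star V c \<inter> cg_edges V" "connected_on V T"
    unfolding contains_simple_spanning_def by blast
  have "V \<noteq> {c}" using assms by auto
  then obtain u where "u \<in> V" "c \<noteq> u" using assms(1) by blast
  then obtain w where w: "{c, w} \<in> T \<inter> cg_edges V" using connected_on_ex_edge[OF T(2) assms(1)] by blast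
  then have "{c, w} \<in> star V c" unfolding star_def by simp
  then show False using w T(1) by blast
qed

lemma card_blocking_ge:
  assumes gp: "general_position V" and V: "V \<noteq> {}"
    and B: "B \<subseteq> cg_edges V" "\<not> contains_simple_spanning (- B) V"
  shows "card V \<le> card B + 1"
  using connected_on_card[OF general_position_finite[OF gp] V B(1)]
    connected_on_of_blocking[OF gp order_refl V B(2)] by blast

text \<open>Any blocking set is connected on V, so it has at least |V| - 1 edges; a star attains
  this bound.\<close>

lemma blocker_iff_tight:
  assumes gp: "general_position V" and c2: "card V \<ge> 2"
  shows "blocker V (SSTs V) B \<longleftrightarrow> tight_blocker V B"
proof -
  have fin: "finite V" by (rule general_position_finite[OF gp])
  have ne: "V \<noteq> {}" using c2 by auto
  then obtain c where c: "c \<in> V" by blast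
  have star: "star V c \<subseteq> cg_edges V" unfolding star_def by blast
  note blocks = blocks_SSTs_iff[OF fin]
  have ge: "card V \<le> card B' + 1" if "B' \<subseteq> cg_edges V" "blocks (SSTs V) B'" for B'
    using card_blocking_ge[OF gp ne that(1)] that(2) blocks by blast
  have star_b: "blocks (SSTs V) (star V c)" using star_blocks[OF c c2] blocks by blast
  show ?thesis
  proof
    assume b: "blocker V (SSTs V) B"
    then have "card B \<le> card (star V c)" using star star_b unfolding blocker_def by blast
    moreover have "card V \<le> card B + 1" using ge b unfolding blocker_def by blast
    ultimately have "card B + 1 = card V" using card_star[OF fin c] by simp
    then show "tight_blocker V B" using b blocks unfolding tight_blocker_def blocker_def by blast
  next
    assume t: "tight_blocker V B"
    have "card B \<le> card B'" if "B' \<subseteq> cg_edges V" "blocks (SSTs V) B'" for B'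
      using ge[OF that] t unfolding tight_blocker_def by simp
    then show "blocker V (SSTs V) B" using t blocks unfolding tight_blocker_def blocker_def by blast
  qed
qed

text \<open>Two vertices are required: for a single vertex the star is empty, whereas the only
  spanning tree is the empty one, which nothing blocks.\<close>

theorem theorem1:
  fixes V :: "point set" and B :: "edge set"
  assumes "general_position V" and "card V \<ge> 2"
  shows "blocker V (SSTs V) B \<longleftrightarrow> is_star V B \<or> comb V B"
  unfolding blocker_iff_tight[OF assms]
proof
  assume "tight_blocker V B"
  then show "is_star V B \<or> comb V B" using nonstar_tight_blocker_is_comb[OF assms(1)] by blast
next
  have fin: "finite V" by (rule general_position_finite[OF assms(1)])
  assume "is_star V B \<or> comb V B"
  then show "tight_blocker V B"
  proof
    assume "is_star V B"
    then obtain c where c: "c \<in> V" "B = star V c" unfolding is_star_def by blast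
    have "star V c \<subseteq> cg_edges V" unfolding star_def by blast
    then show ?thesis using card_star[OF fin c(1)] star_blocks[OF c(1) assms(2)] c(2)
      unfolding tight_blocker_def by simp
  next
    assume c: "comb V B"
    have sub: "B \<subseteq> cg_edges V" using c unfolding comb_def by (rule conjunct1)
    have b: "\<not> contains_simple_spanning (- B) V" by (rule comb_blocks[OF assms(1) c assms(2)])
    have "V \<noteq> {}" using assms(2) by auto
    then have "card B + 1 = card V"
      using card_blocking_ge[OF assms(1) _ sub b] comb_card[OF fin c] by simp
    then show ?thesis using sub b unfolding tight_blocker_def by blast
  qed
qed

end
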